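(* Let $H$ be a complex Hilbert space with $\dim H\ge 3$, and let $\mathcal A$ and $\mathcal B$ be subsets of $\mathcal B(H)$ each of which contains $\mathcal F_1(H)$. Suppose $\Phi:\mathcal A\to\mathcal B$ is a surjective map such that $$A^*B=0\iff \Phi(A)^*\Phi(B)=0\qquad\text{for all }A,B\in\mathcal A.$$ (Under these hypotheses $\Phi$ preserves rank one operators in both directions, and there exist a unitary $U_0\in\mathcal B(H)$ and a map $h:H\times H\to H$ such that either $\Phi(x\otimes f)=U_0x\otimes h(x,f)$ for all $x,f\in H$, or $\Phi(x\otimes f)=U_0Jx\otimes h(x,f)$ for all $x,f\in H$; the map $h$ below is this one.) Assume that $F:\mathcal F_1(H)\cup\{0\}\to[0,+\infty)$ is a function such that $$F(\Phi(A)^*\Phi(B))=F(A^*B)\qquad\text{whenever } A \text{ or } B \text{ has rank one}\quad(A,B\in\mathcal A).$$ Consider the following properties of $F$: (F1) $F(\mu UXU^* )=F(X)$ for any $\mu\in\mathbb C$ with $|\mu|=1$, any $X\in\mathcal F_1(H)$ and any unitary $U\in\mathcal B(H)$. (F2) For any $X\in\mathcal F_1(H)$, the map $t\mapsto F(tX)$ on $[0,\infty)$ is strictly increasing. (F3) The set $\{F(X):X\in\mathcal F_1(H),\ \|X\|=1\}$ attains its maximum and minimum. If (F1) and (F2) hold, then $\|h(x,f)\|=\|f\|$ for all $x,f\in H$. If, in addition, (F3) is satisfied, then there exist a unitary $U$ and a partial isometry $V_A$ in $\mathcal B(H)$, where $V_A$ depends on $A$ and $V_A^*V_A$ is the right support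 projection of $A$, such that either $$\Phi(A)=UAV_A^*\quad\text{for every }A\in\mathcal A,$$ or $$\Phi(A)=U\,JAJ\,V_A^*\quad\text{for every }A\in\mathcal A.$$
   Context: $\mathcal B(H)$ is the algebra of all bounded linear operators on $H$, and $\mathcal F_1(H)$ is the set of all rank one operators in $\mathcal B(H)$. For $x,f\in H$, $x\otimes f$ denotes the operator $z\mapsto\langle z,f\rangle x$. An arbitrary orthogonal basis $\{e_i\}_{i\in\Gamma}$ of $H$ is fixed, and $J:H\to H$ is the conjugation $J\left(\sum_i\xi_ie_i\right)=\sum_i\overline{\xi_i}e_i$; thus $JAJ$ is a bounded linear operator for $A\in\mathcal B(H)$. The right support projection of $A$ is the orthogonal projection onto $(\ker A)^\perp=\overline{\operatorname{ran}A^*}$. "$\Phi$ preserves rank one operators in both directions" means that for $A\in\mathcal A$, $A$ has rank one if and only if $\Phi(A)$ has rank one.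
   Formalization: In the JAJ alternative, V_A^*V_A is the right support projection of JAJ, not of A (else false for Φ(A)=JAJ). The form of Φ(x⊗f) is claimed only if x⊗f ∈ A; ‖h(x,f)‖=‖f‖ holds for all x,f for a suitable h, and for every such h when x≠0 and x⊗f ∈ A. *)

theory Defs
  imports "HOL-Analysis.Analysis"
begin

(* A complex Hilbert space whose norm and topology are the library's ones: the real inner product
   is the real part of the complex one, so norm x = sqrt (Re (cinner x x)).  The complex inner
   product is linear in its first argument.  Homogeneity over 1 and positivity are inherited
   from real_inner. *)
class complex_hilbert = real_inner + complete_space +
  fixes scaleC :: "complex \<Rightarrow> 'a \<Rightarrow> 'a"  (infixr "*\<^sub>C" 75)
    and cinner :: "'a \<Rightarrow> 'a \<Rightarrow> complex"
  assumes scaleC_add_right: "c *\<^sub>C (x + y) = c *\<^sub>C x + c *\<^sub>C y"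
    and scaleC_add_left: "(c + d) *\<^sub>C x = c *\<^sub>C x + d *\<^sub>C x"
    and scaleC_scaleC: "c *\<^sub>C (d *\<^sub>C x) = (c * d) *\<^sub>C x"
    and scaleC_of_real: "complex_of_real r *\<^sub>C x = r *\<^sub>R x"
    and cinner_commute: "cinner x y = cnj (cinner y x)"
    and cinner_add_left: "cinner (x + y) z = cinner x z + cinner y z"
    and cinner_scaleC_left: "cinner (c *\<^sub>C x) y = c * cinner x y"
    and inner_eq_Re_cinner: "x \<bullet> y = Re (cinner x y)"

global_interpretation complex_vector:
  vector_space "scaleC :: complex \<Rightarrow> 'a \<Rightarrow> 'a::complex_hilbert"
proof
  show "1 *\<^sub>C x = x" for x :: 'a
    using scaleC_of_real[of 1 x] by simp
qed (simp_all add: scaleC_add_right scaleC_add_left scaleC_scaleC)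

definition bounded_ops :: "('a::complex_hilbert \<Rightarrow> 'a) set" where
  "bounded_ops = {A. bounded_linear A \<and> (\<forall>c x. A (c *\<^sub>C x) = c *\<^sub>C A x)}"

(* For A in bounded_ops the adjoint exists and is unique by the Riesz representation theorem. *)
definition cadj :: "('a::complex_hilbert \<Rightarrow> 'a) \<Rightarrow> 'a \<Rightarrow> 'a" where
  "cadj A = (THE B. \<forall>x y. cinner (A x) y = cinner x (B y))"

definition rank_one_ops :: "('a::complex_hilbert \<Rightarrow> 'a) set" where
  "rank_one_ops = {A \<in> bounded_ops. complex_vector.dim (range A) = 1}"

definition outer_prod :: "'a::complex_hilbert \<Rightarrow> 'a \<Rightarrow> 'a \<Rightarrow> 'a" where
  "outer_prod x f = (\<lambda>z. cinner z f *\<^sub>C x)"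

definition unitary_op :: "('a::complex_hilbert \<Rightarrow> 'a) \<Rightarrow> bool" where
  "unitary_op U \<longleftrightarrow> U \<in> bounded_ops \<and> cadj U \<circ> U = id \<and> U \<circ> cadj U = id"

definition kernel :: "('a::complex_hilbert \<Rightarrow> 'a) \<Rightarrow> 'a set" where
  "kernel A = {x. A x = 0}"

definition corthogonal_comp :: "'a::complex_hilbert set \<Rightarrow> 'a set" where
  "corthogonal_comp S = {x. \<forall>y\<in>S. cinner x y = 0}"

(* Intended for closed complex subspaces M only. *)
definition orth_projection :: "'a::complex_hilbert set \<Rightarrow> 'a \<Rightarrow> 'a" where
  "orth_projection M x = (THE y. y \<in> M \<and> x - y \<in> corthogonal_comp M)"

definition right_support :: "('a::complex_hilbert \<Rightarrow> 'a) \<Rightarrow> 'a \<Rightarrow> 'a" where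
  "right_support A = orth_projection (corthogonal_comp (kernel A))"

definition partial_isometry :: "('a::complex_hilbert \<Rightarrow> 'a) \<Rightarrow> bool" where
  "partial_isometry V \<longleftrightarrow>
     V \<in> bounded_ops \<and> (\<forall>x \<in> corthogonal_comp (kernel V). norm (V x) = norm x)"

(* The vectors need not be normalised.  The cardinality of E is the Hilbert space dimension. *)
definition orthogonal_basis :: "'a::complex_hilbert set \<Rightarrow> bool" where
  "orthogonal_basis E \<longleftrightarrow>
     0 \<notin> E \<and> (\<forall>e\<in>E. \<forall>e'\<in>E. e \<noteq> e' \<longrightarrow> cinner e e' = 0) \<and>
     closure (complex_vector.span E) = UNIV"

(* cinner x e / cinner e e is the coefficient of x at e in the expansion along E. *)
definition conjugation :: "'a::complex_hilbert set \<Rightarrow> 'a \<Rightarrow> 'a" where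
  "conjugation E x = (\<Sum>\<^sub>\<infinity>e\<in>E. cnj (cinner x e / cinner e e) *\<^sub>C e)"

(* The rank one form of Phi.  The premise outer_prod x f : AA excludes only the zero operator
   (x = 0 or f = 0) in the case that it does not belong to the domain AA of Phi. *)
definition rank_one_form ::
  "'a::complex_hilbert set \<Rightarrow> ('a \<Rightarrow> 'a) set \<Rightarrow> (('a \<Rightarrow> 'a) \<Rightarrow> 'a \<Rightarrow> 'a) \<Rightarrow>
    ('a \<Rightarrow> 'a) \<Rightarrow> ('a \<Rightarrow> 'a \<Rightarrow> 'a) \<Rightarrow> bool" where
  "rank_one_form E AA \<Phi> U h \<longleftrightarrow> unitary_op U \<and>
     ((\<forall>x f. outer_prod x f \<in> AA \<longrightarrow> \<Phi> (outer_prod x f) = outer_prod (U x) (h x f)) \<or>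
      (\<forall>x f. outer_prod x f \<in> AA \<longrightarrow>
         \<Phi> (outer_prod x f) = outer_prod (U (conjugation E x)) (h x f)))"

definition unitarily_invariant :: "(('a::complex_hilbert \<Rightarrow> 'a) \<Rightarrow> real) \<Rightarrow> bool" where
  "unitarily_invariant F \<longleftrightarrow>
     (\<forall>\<mu> X U. cmod \<mu> = 1 \<and> X \<in> rank_one_ops \<and> unitary_op U \<longrightarrow>
        F (\<lambda>z. \<mu> *\<^sub>C U (X (cadj U z))) = F X)"

definition strictly_increasing_on_rays :: "(('a::complex_hilbert \<Rightarrow> 'a) \<Rightarrow> real) \<Rightarrow> bool" where
  "strictly_increasing_on_rays F \<longleftrightarrow>
     (\<forall>X\<in>rank_one_ops. strict_mono_on {0..} (\<lambda>t::real. F (\<lambda>z. t *\<^sub>R X z)))"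

definition attains_extrema :: "(('a::complex_hilbert \<Rightarrow> 'a) \<Rightarrow> real) \<Rightarrow> bool" where
  "attains_extrema F \<longleftrightarrow>
     (let S = {F X |X. X \<in> rank_one_ops \<and> onorm X = 1}
      in (\<exists>M\<in>S. \<forall>s\<in>S. s \<le> M) \<and> (\<exists>m\<in>S. \<forall>s\<in>S. m \<le> s))"

end

theory Submission
  imports Defs
begin

text \<open>The relation \<open>A\<^sup>*B = 0\<close> says that the ranges of \<open>A\<close> and \<open>B\<close> are orthogonal, so it sees only closed
  ranges. Among the nonzero operators those of rank one are the ones for which the set of
  operators orthogonal to them is maximal (\<open>rank_one_iff_minimal\<close>); this description survives \<open>\<Phi>\<close>
  in both directions, and \<open>\<Phi>\<close> therefore induces a map of the rays of \<open>H\<close> that is onto and preserves orthogonality both ways.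
  By Uhlhorn's theorem (\<open>orthogonality_preserving_rays\<close>) it comes from a unitary or an antiunitary
  \<open>T\<close>, and \<open>T\<close> is \<open>U\<close> or \<open>U \<circ> J\<close> with \<open>U\<close> unitary. That is the rank one form.

  For Uhlhorn's theorem fix a unit vector \<open>e\<close>. The affine hyperplane \<open>e + e\<^sup>\<bottom>\<close> is a chart of the rays that
  are not orthogonal to \<open>e\<close>, and in this chart the ray map becomes a map \<open>S\<close> from \<open>e\<^sup>\<bottom>\<close>
  to \<open>e'\<^sup>\<bottom>\<close>, where \<open>e'\<close> is a unit vector on the image ray of \<open>e\<close>. It is additive
  because planes, being double orthogonal complements of two vectors, go to planes; here a third
  dimension is needed. It is semilinear with a ring endomorphism \<open>\<sigma>\<close> of the complex numbers. As
  \<open>e + x\<close> and \<open>e + y\<close> are orthogonal exactly when \<open>cinner x y = -1\<close>, the map \<open>S\<close> respects this value, and by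
  scaling \<open>cinner (S x) (S y) = \<sigma> (cinner x y)\<close> throughout, with \<open>\<sigma>\<close> commuting with conjugation. So \<open>\<sigma>\<close>
  maps reals to reals and squares to squares, is monotone there, and fixes them; this leaves only the
  identity and complex conjugation.

  The function \<open>F\<close> supplies the norms. For \<open>A = B = x \<otimes> f\<close> the product \<open>A\<^sup>*B\<close> is \<open>\<parallel>x\<parallel>\<^sup>2 f \<otimes> f\<close>, and on the
  operators \<open>f \<otimes> f\<close> an invariant \<open>F\<close> is a strictly increasing function of the norm of \<open>f\<close>, so
  \<open>\<parallel>h(x,f)\<parallel> = \<parallel>f\<parallel>\<close>. For \<open>A = x \<otimes> f\<close> and arbitrary \<open>B\<close> one compares \<open>f \<otimes> B\<^sup>*x\<close> with
  \<open>h(x,f) \<otimes> \<Phi>(B)\<^sup>*Tx\<close>. Choosing \<open>f\<close> such that the first operator maximises, respectively minimises, \<open>F\<close> on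
  the unit sphere gives the two inequalities between the norms of \<open>\<Phi>(B)\<^sup>*Tx\<close> and \<open>B\<^sup>*x\<close>
  (\<open>norm_eq_of_F_tests\<close>). Operators whose adjoints have equal norms at every vector differ by a partial
  isometry on the right (\<open>factor_through_partial_isometry\<close>), which is the asserted form of \<open>\<Phi>(B)\<close>.\<close>

section \<open>Complex Hilbert spaces\<close>

instance complex_hilbert \<subseteq> banach ..

declare cinner_scaleC_left [simp]

lemma cinner_zero_left [simp]: "cinner 0 x = 0"
  using cinner_add_left[of 0 0 x] by simp

lemma cinner_zero_right [simp]: "cinner x 0 = 0"
  using cinner_commute[of x 0] by simp

lemma cinner_add_right: "cinner x (y + z) = cinner x y + cinner x z"
  by (metis cinner_add_left cinner_commute complex_cnj_add)

lemma cinner_scaleC_right [simp]: "cinner x (c *\<^sub>C y) = cnj c * cinner x y"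
  by (metis cinner_scaleC_left cinner_commute complex_cnj_mult)

lemma cinner_minus_left [simp]: "cinner (- x) y = - cinner x y"
  using cinner_add_left[of "- x" x y] by (simp add: eq_neg_iff_add_eq_0)

lemma cinner_minus_right [simp]: "cinner x (- y) = - cinner x y"
  using cinner_add_right[of x "- y" y] by (simp add: eq_neg_iff_add_eq_0)

lemma cinner_diff_left: "cinner (x - y) z = cinner x z - cinner y z"
  using cinner_add_left[of x "- y" z] by simp

lemma cinner_diff_right: "cinner x (y - z) = cinner x y - cinner x z"
  using cinner_add_right[of x y "- z"] by simp

lemmas cinner_expand = cinner_add_left cinner_add_right cinner_diff_left cinner_diff_right
  cinner_scaleC_left cinner_scaleC_right

lemma cinner_scaleR_left [simp]: "cinner (r *\<^sub>R x) y = complex_of_real r * cinner x y"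
  by (metis cinner_scaleC_left scaleC_of_real)

lemma cinner_scaleR_right [simp]: "cinner x (r *\<^sub>R y) = complex_of_real r * cinner x y"
  by (metis cinner_scaleC_right scaleC_of_real complex_cnj_complex_of_real)

lemma cinner_eq_0_commute: "cinner x y = 0 \<longleftrightarrow> cinner y x = 0"
  by (metis cinner_commute complex_cnj_zero_iff)

lemma cinner_eq_0_sym: "cinner x y = 0 \<Longrightarrow> cinner y x = 0"
  by (simp add: cinner_eq_0_commute)

lemma cinner_self: "cinner x x = complex_of_real ((norm x)\<^sup>2)"
proof -
  have "cinner x x = cnj (cinner x x)" by (rule cinner_commute)
  then have "Im (cinner x x) = 0" by (simp add: complex_eq_iff)
  then show ?thesis
    by (simp add: complex_eq_iff power2_norm_eq_inner inner_eq_Re_cinner)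
qed

lemma cinner_self_eq_0 [simp]: "cinner x x = 0 \<longleftrightarrow> x = 0"
  by (simp add: cinner_self)

lemma cinner_eqI: "(\<And>z. cinner x z = cinner y z) \<Longrightarrow> x = y"
  by (metis cinner_diff_left cinner_self_eq_0 right_minus_eq)

lemma cinner_eqI_right: "(\<And>z. cinner z x = cinner z y) \<Longrightarrow> x = y"
  by (metis cinner_diff_right cinner_self_eq_0 right_minus_eq)

lemma norm_scaleC [simp]: "norm (c *\<^sub>C x) = cmod c * norm x"
proof -
  have "complex_of_real ((norm (c *\<^sub>C x))\<^sup>2) = complex_of_real ((cmod c * norm x)\<^sup>2)"
    unfolding cinner_self[symmetric] power_mult_distrib of_real_mult complex_norm_square
    by simp
  then have "(norm (c *\<^sub>C x))\<^sup>2 = (cmod c * norm x)\<^sup>2"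
    by (simp only: of_real_eq_iff)
  then show ?thesis by (simp add: power2_eq_iff_nonneg)
qed

text \<open>A phase factor turns \<open>cinner x y\<close> into its modulus, which is then a value of the real inner
  product; so the real Cauchy-Schwarz inequality suffices.\<close>

lemma norm_cinner_le: "cmod (cinner x y) \<le> norm x * norm y"
proof (cases "cinner x y = 0")
  case False
  define c where "c = cnj (cinner x y) / of_real (cmod (cinner x y))"
  have "cmod c = 1" using False by (simp add: c_def norm_divide)
  have "c * cinner x y = of_real (cmod (cinner x y))"
    using False by (simp add: c_def complex_norm_square[symmetric] power2_eq_square
        mult.commute[of "cnj _"] field_simps)
  then have "cmod (cinner x y) = (c *\<^sub>C x) \<bullet> y"
    by (simp add: inner_eq_Re_cinner cinner_scaleC_left)
  also have "\<dots> \<le> norm (c *\<^sub>C x) * norm y" by (rule norm_cauchy_schwarz)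
  finally show ?thesis using \<open>cmod c = 1\<close> by simp
qed simp

lemma bounded_linear_scaleC: "bounded_linear (\<lambda>x. c *\<^sub>C x)"
proof (rule bounded_linear_intro)
  show "c *\<^sub>C (r *\<^sub>R x) = r *\<^sub>R c *\<^sub>C x" for r x
    unfolding scaleC_of_real[symmetric] scaleC_scaleC by (simp add: mult.commute)
  show "norm (c *\<^sub>C x) \<le> norm x * cmod c" for x by simp
qed (rule scaleC_add_right)

lemma bounded_linear_cinner_left: "bounded_linear (\<lambda>x. cinner x y)"
  by (rule bounded_linear_intro[of _ "norm y"])
    (auto simp: cinner_add_left norm_cinner_le scaleR_conv_of_real)

lemma bounded_linear_cinner_right: "bounded_linear (\<lambda>y. cinner x y)"
  by (rule bounded_linear_intro[of _ "norm x"])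
    (auto simp: cinner_add_right scaleR_conv_of_real mult.commute[of "norm _" "norm x"] norm_cinner_le)

lemmas tendsto_cinner_left = bounded_linear.tendsto[OF bounded_linear_cinner_left]
lemmas tendsto_cinner_right = bounded_linear.tendsto[OF bounded_linear_cinner_right]
lemmas cinner_sum_left = linear_sum[OF bounded_linear.linear[OF bounded_linear_cinner_left]]
lemmas cinner_sum_right = linear_sum[OF bounded_linear.linear[OF bounded_linear_cinner_right]]

lemma norm_eq_iff_cinner: "norm x = norm y \<longleftrightarrow> cinner x x = cinner y y"
  unfolding cinner_self of_real_eq_iff by (simp add: power2_eq_iff_nonneg)

lemma scaleC_minus_one [simp]: "(-1) *\<^sub>C x = - x"
  by (metis complex_vector.scale_minus_left complex_vector.scale_one)

lemma unit_multiple: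
  assumes "x \<noteq> 0" shows "norm (x /\<^sub>R norm x) = 1" "(norm x) *\<^sub>R (x /\<^sub>R norm x) = x"
  using assms by auto

section \<open>Orthogonal decomposition and adjoints\<close>

definition csubspace_closed :: "'a::complex_hilbert set \<Rightarrow> bool" where
  "csubspace_closed M \<longleftrightarrow> complex_vector.subspace M \<and> closed M"

lemma csubspace_closedD:
  assumes "csubspace_closed M"
  shows "0 \<in> M" "\<And>x y. x \<in> M \<Longrightarrow> y \<in> M \<Longrightarrow> x + y \<in> M" "\<And>c x. x \<in> M \<Longrightarrow> c *\<^sub>C x \<in> M"
    "\<And>x y. x \<in> M \<Longrightarrow> y \<in> M \<Longrightarrow> x - y \<in> M" "\<And>r x. x \<in> M \<Longrightarrow> r *\<^sub>R x \<in> M" "closed M"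
  using assms complex_vector.subspace_diff scaleC_of_real
  by (auto simp: csubspace_closed_def complex_vector.subspace_def scaleC_of_real[symmetric])

lemma corthogonal_comp_closed_subspace: "csubspace_closed (corthogonal_comp S)"
proof -
  have eq: "corthogonal_comp S = (\<Inter>y\<in>S. (\<lambda>x. cinner x y) -` {0})"
    by (auto simp: corthogonal_comp_def)
  have "closed (corthogonal_comp S)"
    unfolding eq
    by (intro closed_INT ballI closed_vimage closed_singleton linear_continuous_on
        bounded_linear_cinner_left)
  then show ?thesis
    by (auto simp: csubspace_closed_def complex_vector.subspace_def corthogonal_comp_def cinner_expand)
qed

text \<open>A minimising sequence for the distance of \<open>x\<close> to the subspace is Cauchy by the parallelogram law;
  its limit is the foot of the perpendicular.\<close>

lemma projection_exists:
  assumes M: "csubspace_closed M"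
  shows "\<exists>y\<in>M. x - y \<in> corthogonal_comp M"
proof -
  note M' = csubspace_closedD[OF M]
  define d where "d = infdist x M"
  have "M \<noteq> {}" using M' by auto
  have d_le: "d \<le> norm (x - y)" if "y \<in> M" for y
    using infdist_le[OF that, of x] by (simp add: d_def dist_norm)
  have "\<exists>y\<in>M. norm (x - y) < d + 1 / Suc n" for n
  proof -
    have "Inf ((\<lambda>a. dist x a) ` M) < d + 1 / Suc n"
      unfolding d_def infdist_notempty[OF \<open>M \<noteq> {}\<close>] by simp
    then show ?thesis
      using \<open>M \<noteq> {}\<close> by (subst (asm) cInf_less_iff) (auto simp: dist_norm intro!: bdd_belowI[of _ 0])
  qed
  then obtain y where y: "\<And>n. y n \<in> M" "\<And>n. norm (x - y n) < d + 1 / Suc n"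
    by metis
  have d0: "d \<ge> 0" by (simp add: d_def infdist_nonneg)
  (* Parallelogram law: the midpoint of y m and y n lies in M, so its distance to x is at least d. *)
  have key: "(norm (y m - y n))\<^sup>2 \<le> 4 * (2 * d + 1) / Suc N" if "m \<ge> N" "n \<ge> N" for m n N
  proof -
    have mid: "d \<le> norm (x - (1/2) *\<^sub>R (y m + y n))" by (intro d_le M' y)
    have sq: "(norm (x - y k))\<^sup>2 \<le> d\<^sup>2 + (2 * d + 1) / Suc N" if "k \<ge> N" for k
    proof -
      have "norm (x - y k) \<le> d + 1 / Suc N"
        using y(2)[of k] that by (smt (verit) frac_le of_nat_0_less_iff of_nat_mono zero_less_Suc Suc_le_mono)
      then have "(norm (x - y k))\<^sup>2 \<le> (d + 1 / Suc N)\<^sup>2" by (simp add: power_mono)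
      also have "\<dots> = d\<^sup>2 + (2 * d + 1 / Suc N) / Suc N"
        unfolding power2_eq_square add_divide_distrib distrib_left distrib_right by simp
      also have "\<dots> \<le> d\<^sup>2 + (2 * d + 1) / Suc N"
        by (intro add_left_mono divide_right_mono) auto
      finally show ?thesis .
    qed
    have "(norm (y m - y n))\<^sup>2 =
        2 * (norm (x - y m))\<^sup>2 + 2 * (norm (x - y n))\<^sup>2 - 4 * (norm (x - (1/2) *\<^sub>R (y m + y n)))\<^sup>2"
      unfolding power2_norm_eq_inner by (simp add: algebra_simps inner_commute)
    moreover have "d\<^sup>2 \<le> (norm (x - (1/2) *\<^sub>R (y m + y n)))\<^sup>2"
      using mid d0 by (simp add: power_mono)
    ultimately have "(norm (y m - y n))\<^sup>2 \<le> 4 * ((2 * d + 1) / Suc N)"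
      using sq[OF that(1)] sq[OF that(2)] by argo
    then show ?thesis by simp
  qed
  have "Cauchy y"
  proof (rule metric_CauchyI)
    fix e :: real assume "e > 0"
    obtain N :: nat where N: "4 * (2 * d + 1) / e\<^sup>2 < N" using reals_Archimedean2 by blast
    have "dist (y m) (y n) < e" if "m \<ge> N" "n \<ge> N" for m n
    proof -
      have "4 * (2 * d + 1) < e\<^sup>2 * Suc N"
        using N \<open>e > 0\<close> by (simp add: divide_less_eq algebra_simps) (smt (verit) zero_less_power)
      then have "4 * (2 * d + 1) / Suc N < e\<^sup>2" by (simp add: divide_less_eq)
      then have "(norm (y m - y n))\<^sup>2 < e\<^sup>2" using key[OF that] by linarith
      then show ?thesis using \<open>e > 0\<close> by (simp add: dist_norm power_less_imp_less_base)
    qed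
    then show "\<exists>N. \<forall>m\<ge>N. \<forall>n\<ge>N. dist (y m) (y n) < e" by blast
  qed
  then obtain p where p: "y \<longlonglongrightarrow> p" using Cauchy_convergent convergent_def by blast
  have pM: "p \<in> M" using closed_sequentially[OF M'(6) y(1) p] .
  have "norm (x - p) \<le> d"
  proof (rule LIMSEQ_le)
    show "(\<lambda>n. norm (x - y n)) \<longlonglongrightarrow> norm (x - p)" by (intro tendsto_intros p)
    show "(\<lambda>n. d + 1 / Suc n) \<longlonglongrightarrow> d"
      using tendsto_add[OF tendsto_const[of d] LIMSEQ_inverse_real_of_nat] by (simp add: inverse_eq_divide)
    show "\<exists>N. \<forall>n\<ge>N. norm (x - y n) \<le> d + 1 / Suc n" using y(2) less_imp_le by blast
  qed
  then have min: "norm (x - p) \<le> norm (x - z)" if "z \<in> M" for z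
    using d_le[OF that] by linarith
  have "cinner (x - p) z = 0" if z: "z \<in> M" for z
  proof (cases "z = 0")
    case False
    (* p + c *C z is the nearest point to x on the line through p in direction z. *)
    define c where "c = cinner (x - p) z / cinner z z"
    have nz: "cinner z z \<noteq> 0" using False by simp
    have orth: "cinner (x - p - c *\<^sub>C z) (c *\<^sub>C z) = 0"
      using nz by (simp add: cinner_expand c_def)
    then have "(x - p - c *\<^sub>C z) \<bullet> (c *\<^sub>C z) = 0" by (simp only: inner_eq_Re_cinner orth zero_complex.sel)
    then have "(norm (x - p))\<^sup>2 = (norm (x - p - c *\<^sub>C z))\<^sup>2 + (norm (c *\<^sub>C z))\<^sup>2"
      unfolding power2_norm_eq_inner by (simp add: algebra_simps inner_commute)
    moreover have "norm (x - p) \<le> norm (x - (p + c *\<^sub>C z))"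
      by (intro min M' pM z)
    then have "(norm (x - p))\<^sup>2 \<le> (norm (x - p - c *\<^sub>C z))\<^sup>2" by (simp add: power_mono algebra_simps)
    ultimately have "norm (c *\<^sub>C z) = 0" by simp
    then show ?thesis using False nz by (simp add: c_def)
  qed simp
  then show ?thesis using pM by (auto simp: corthogonal_comp_def)
qed

lemma projection_unique:
  assumes M: "csubspace_closed M" and "y \<in> M" "x - y \<in> corthogonal_comp M"
    and "z \<in> M" "x - z \<in> corthogonal_comp M"
  shows "y = z"
proof -
  have "(x - z) - (x - y) \<in> corthogonal_comp M"
    using assms csubspace_closedD(4)[OF corthogonal_comp_closed_subspace] by blast
  then have "cinner (y - z) (y - z) = 0"
    using csubspace_closedD(4)[OF M] assms by (simp add: corthogonal_comp_def)
  then show ?thesis by simp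
qed

lemma orth_projection_props:
  assumes M: "csubspace_closed M"
  shows "orth_projection M x \<in> M" "x - orth_projection M x \<in> corthogonal_comp M"
proof -
  have "\<exists>!y. y \<in> M \<and> x - y \<in> corthogonal_comp M"
    using projection_exists[OF M] projection_unique[OF M] by blast
  from theI'[OF this] show "orth_projection M x \<in> M" "x - orth_projection M x \<in> corthogonal_comp M"
    unfolding orth_projection_def by auto
qed

lemma orth_projection_eqI:
  assumes "csubspace_closed M" "y \<in> M" "x - y \<in> corthogonal_comp M"
  shows "orth_projection M x = y"
  using projection_unique[OF assms(1)] orth_projection_props[OF assms(1)] assms by blast

lemma double_corthogonal_comp:
  assumes "csubspace_closed M"
  shows "corthogonal_comp (corthogonal_comp M) = M"
proof
  show "M \<subseteq> corthogonal_comp (corthogonal_comp M)"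
    by (auto simp: corthogonal_comp_def cinner_eq_0_commute)
next
  show "corthogonal_comp (corthogonal_comp M) \<subseteq> M"
  proof
    fix x assume x: "x \<in> corthogonal_comp (corthogonal_comp M)"
    define p where "p = orth_projection M x"
    note p = orth_projection_props[OF assms, of x, folded p_def]
    have "cinner x (x - p) = 0" "cinner p (x - p) = 0"
      using p x by (auto simp: corthogonal_comp_def cinner_eq_0_commute[of p])
    then have "cinner (x - p) (x - p) = 0" by (simp add: cinner_diff_left)
    then show "x \<in> M" using p by simp
  qed
qed

lemma bounded_opsD:
  assumes "A \<in> bounded_ops"
  shows "bounded_linear A" "A (x + y) = A x + A y" "A (x - y) = A x - A y" "A (c *\<^sub>C x) = c *\<^sub>C A x" "A 0 = 0"
    "A (r *\<^sub>R x) = r *\<^sub>R A x"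
  using assms by (auto simp: bounded_ops_def linear_simps)

lemma bounded_opsI:
  assumes "\<And>x y. A (x + y) = A x + A y" "\<And>c x. A (c *\<^sub>C x) = c *\<^sub>C A x" "\<And>x. norm (A x) \<le> K * norm x"
  shows "A \<in> bounded_ops"
proof -
  have "bounded_linear A"
    by (rule bounded_linear_intro[of _ K])
      (auto simp: assms scaleC_of_real[symmetric] mult.commute[of _ K])
  then show ?thesis using assms by (simp add: bounded_ops_def)
qed

lemma bounded_ops_comp: "A \<in> bounded_ops \<Longrightarrow> B \<in> bounded_ops \<Longrightarrow> A \<circ> B \<in> bounded_ops"
  by (auto simp: bounded_ops_def o_def intro: bounded_linear_compose)

text \<open>The Riesz representation: the functional is a multiple of the inner product with a normal
  of its kernel.\<close>

lemma riesz_representation: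
  fixes g :: "'a::complex_hilbert \<Rightarrow> complex"
  assumes g: "bounded_linear g" and gC: "\<And>c x. g (c *\<^sub>C x) = c * g x"
  shows "\<exists>f. \<forall>x. g x = cinner x f"
proof (cases "\<forall>x. g x = 0")
  case False
  then obtain x0 where x0: "g x0 \<noteq> 0" by blast
  have add: "g (x + y) = g x + g y" "g (x - y) = g x - g y" for x y
    using g by (simp_all add: linear_simps)
  define M where "M = g -` {0}"
  have "closed M" unfolding M_def
    by (intro closed_vimage closed_singleton linear_continuous_on g)
  then have M: "csubspace_closed M"
    using g by (auto simp: csubspace_closed_def complex_vector.subspace_def M_def add gC linear_simps)
  define z where "z = x0 - orth_projection M x0"
  have z: "z \<in> corthogonal_comp M" unfolding z_def by (rule orth_projection_props[OF M])
  have gz: "g z \<noteq> 0"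
    using orth_projection_props(1)[OF M, of x0] x0 by (simp add: z_def add M_def)
  then have "z \<noteq> 0" using g by (auto simp: linear_simps)
  have "g x = cinner x (cnj (g z / cinner z z) *\<^sub>C z)" for x
  proof -
    have "x - (g x / g z) *\<^sub>C z \<in> M" using gz by (simp add: M_def add gC)
    then have "cinner (x - (g x / g z) *\<^sub>C z) z = 0"
      using z cinner_eq_0_commute by (auto simp: corthogonal_comp_def)
    then show ?thesis using gz \<open>z \<noteq> 0\<close> by (simp add: cinner_expand field_simps)
  qed
  then show ?thesis by blast
qed (auto intro: exI[of _ 0])

lemma cadj_eqI:
  assumes "\<And>x y. cinner (A x) y = cinner x (B y)"
  shows "cadj A = B"
  unfolding cadj_def
proof (rule the_equality)
  show "C = B" if "\<forall>x y. cinner (A x) y = cinner x (C y)" for C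
    by (rule ext, rule cinner_eqI_right) (metis that assms)
qed (use assms in blast)

lemma cadj_cinner:
  assumes A: "A \<in> bounded_ops"
  shows "cinner (A x) y = cinner x (cadj A y)"
proof -
  have "\<exists>f. \<forall>x. cinner (A x) y = cinner x f" for y
    by (rule riesz_representation)
      (auto intro: bounded_linear_compose[OF bounded_linear_cinner_left bounded_opsD(1)[OF A]]
        simp: bounded_opsD[OF A] cinner_scaleC_left)
  then obtain B where B: "\<And>x y. cinner (A x) y = cinner x (B y)" by metis
  then show ?thesis using cadj_eqI[of A B] by simp
qed

lemma cadj_cinner': "A \<in> bounded_ops \<Longrightarrow> cinner x (A y) = cinner (cadj A x) y"
  by (metis cadj_cinner cinner_commute)

lemma cadj_bounded_ops:
  assumes A: "A \<in> bounded_ops"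
  shows "cadj A \<in> bounded_ops"
proof -
  obtain K where K: "\<And>x. norm (A x) \<le> norm x * K" "K > 0"
    using bounded_linear.pos_bounded[OF bounded_opsD(1)[OF A]] by blast
  show ?thesis
  proof (rule bounded_opsI[of _ K])
    show "cadj A (x + y) = cadj A x + cadj A y" for x y
      by (rule cinner_eqI) (simp add: cinner_expand cadj_cinner'[OF A, symmetric])
    show "cadj A (c *\<^sub>C x) = c *\<^sub>C cadj A x" for c x
      by (rule cinner_eqI) (simp add: cinner_expand cadj_cinner'[OF A, symmetric])
    show "norm (cadj A x) \<le> K * norm x" for x
    proof -
      define y where "y = cadj A x"
      have "(norm y)\<^sup>2 = cmod (cinner y y)" unfolding cinner_self norm_of_real by simp
      also have "cinner y y = cinner x (A y)" by (simp add: cadj_cinner'[OF A] y_def)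
      also have "cmod \<dots> \<le> norm x * norm (A y)" by (rule norm_cinner_le)
      also have "\<dots> \<le> norm x * (norm y * K)" by (intro mult_left_mono K norm_ge_zero)
      finally have "norm y * norm y \<le> (K * norm x) * norm y" by (simp add: power2_eq_square ac_simps)
      then show ?thesis using K unfolding y_def[symmetric]
        by (cases "norm y = 0") (auto simp: mult_le_cancel_right)
    qed
  qed
qed

lemma cadj_cadj: "A \<in> bounded_ops \<Longrightarrow> cadj (cadj A) = A"
  by (rule cadj_eqI) (simp add: cadj_cinner')

lemma cadj_comp: "A \<in> bounded_ops \<Longrightarrow> B \<in> bounded_ops \<Longrightarrow> cadj (A \<circ> B) = cadj B \<circ> cadj A"
  by (rule cadj_eqI) (simp add: cadj_cinner)

text \<open>Polarisation: the norms of sums give the real parts of the inner products, and replacing \<open>x\<close> by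
  \<open>\<i> *\<^sub>C x\<close> gives the imaginary parts.\<close>

lemma cinner_eq_of_norm_eq:
  fixes A B :: "'a::complex_hilbert \<Rightarrow> 'a"
  assumes "\<And>x y. A (x + y) = A x + A y" "\<And>c x. A (c *\<^sub>C x) = c *\<^sub>C A x"
    and "\<And>x y. B (x + y) = B x + B y" "\<And>c x. B (c *\<^sub>C x) = c *\<^sub>C B x"
    and norm: "\<And>x. norm (A x) = norm (B x)"
  shows "cinner (A x) (A y) = cinner (B x) (B y)"
proof -
  have re: "Re (cinner (A x) (A y)) = Re (cinner (B x) (B y))" for x y
  proof -
    have "(norm (A x + A y))\<^sup>2 = (norm (B x + B y))\<^sup>2" by (metis assms(1,3) norm)
    moreover have "(norm (A x))\<^sup>2 = (norm (B x))\<^sup>2" "(norm (A y))\<^sup>2 = (norm (B y))\<^sup>2"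
      by (simp_all add: norm)
    ultimately show ?thesis
      unfolding power2_norm_eq_inner by (simp add: algebra_simps inner_commute inner_eq_Re_cinner[symmetric])
  qed
  show ?thesis
    using re[of x y] re[of "\<i> *\<^sub>C x" y] by (simp add: complex_eq_iff assms)
qed

text \<open>An inner product preserving surjection has its inverse as adjoint.\<close>

lemma unitary_opI:
  assumes add: "\<And>x y. U (x + y) = U x + U y" and scale: "\<And>c x. U (c *\<^sub>C x) = c *\<^sub>C U x"
    and iso: "\<And>x. norm (U x) = norm x" and surj: "\<And>y. \<exists>x. U x = y"
  shows "unitary_op U"
proof -
  have U: "U \<in> bounded_ops" by (rule bounded_opsI[of _ 1]) (simp_all add: assms)
  have "cinner (U x) (U y) = cinner (id x) (id y)" for x y
    by (rule cinner_eq_of_norm_eq) (simp_all add: assms)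
  then have "cadj U (U y) = y" for y
    by (intro cinner_eqI) (simp add: cadj_cinner'[OF U, symmetric])
  then have "cadj U \<circ> U = id" by auto
  moreover have "U \<circ> cadj U = id"
    using \<open>cadj U \<circ> U = id\<close> surj by (metis (mono_tags, opaque_lifting) comp_apply eq_id_iff ext)
  ultimately show ?thesis using U by (simp add: unitary_op_def)
qed

lemma unitary_opD:
  assumes "unitary_op U"
  shows "U \<in> bounded_ops" "cadj U (U x) = x" "U (cadj U x) = x"
    "cinner (U x) (U y) = cinner x y" "norm (U x) = norm x"
    "cinner (cadj U x) (cadj U y) = cinner x y" "norm (cadj U x) = norm x"
proof -
  show U: "U \<in> bounded_ops" using assms by (simp add: unitary_op_def)
  show 1: "cadj U (U x) = x" "U (cadj U x) = x" for x
    using assms by (simp_all add: unitary_op_def fun_eq_iff)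
  show 2: "cinner (U x) (U y) = cinner x y" for x y by (simp add: cadj_cinner[OF U] 1)
  show 3: "cinner (cadj U x) (cadj U y) = cinner x y" for x y by (metis 1 2)
  show "norm (U x) = norm x" "norm (cadj U x) = norm x" by (simp_all add: norm_eq_iff_cinner 2 3)
qed

section \<open>Orthogonal bases and the conjugation\<close>

text \<open>The complement of \<open>x - y\<close> is closed and contains the basis, hence everything, \<open>x - y\<close> included.\<close>

lemma orthogonal_basis_eqI:
  assumes E: "orthogonal_basis E" and eq: "\<And>e. e \<in> E \<Longrightarrow> cinner x e = cinner y e"
  shows "x = y"
proof -
  have M: "csubspace_closed (corthogonal_comp {x - y})" by (rule corthogonal_comp_closed_subspace)
  have "E \<subseteq> corthogonal_comp {x - y}"
  proof
    fix e assume "e \<in> E"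
    then have "cinner (x - y) e = 0" by (simp add: cinner_diff_left eq)
    then show "e \<in> corthogonal_comp {x - y}"
      by (simp add: corthogonal_comp_def cinner_eq_0_commute)
  qed
  then have "closure (complex_vector.span E) \<subseteq> corthogonal_comp {x - y}"
    using M by (intro closure_minimal complex_vector.span_minimal) (auto simp: csubspace_closed_def)
  then have "x - y \<in> corthogonal_comp {x - y}" using E by (auto simp: orthogonal_basis_def)
  then have "cinner (x - y) (x - y) = 0" by (simp add: corthogonal_comp_def)
  then show ?thesis by simp
qed

text \<open>Among all combinations of a finite set \<open>F\<close> of basis vectors the Fourier sum over \<open>F\<close> is nearest
  to \<open>x\<close>, so the density of the span already forces the expansion to converge to \<open>x\<close>.\<close>

lemma basis_expansion:
  assumes E: "orthogonal_basis E"
  shows "((\<lambda>e. (cinner x e / cinner e e) *\<^sub>C e) has_sum x) E"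
  unfolding has_sum_def
proof (rule tendstoI)
  fix \<epsilon> :: real assume "\<epsilon> > 0"
  let ?f = "\<lambda>e. (cinner x e / cinner e e) *\<^sub>C e"
  have "x \<in> closure (complex_vector.span E)" using E by (simp add: orthogonal_basis_def)
  then obtain y where y: "y \<in> complex_vector.span E" "dist y x < \<epsilon>"
    using \<open>\<epsilon> > 0\<close> closure_approachable by blast
  then obtain t r where t: "finite t" "t \<subseteq> E" "y = (\<Sum>a\<in>t. r a *\<^sub>C a)"
    by (auto simp: complex_vector.span_explicit)
  have "dist (sum ?f Y) x < \<epsilon>" if Y: "finite Y" "t \<subseteq> Y" "Y \<subseteq> E" for Y
  proof -
    define p where "p = sum ?f Y"
    have orth: "cinner e (x - p) = 0" if "e \<in> Y" for e
    proof -
      have "cinner p e = (\<Sum>e'\<in>Y. cinner x e' / cinner e' e' * cinner e' e)"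
        unfolding p_def cinner_sum_left by simp
      also have "\<dots> = (\<Sum>e'\<in>Y. if e' = e then cinner x e else 0)"
        by (rule sum.cong) (use E Y \<open>e \<in> Y\<close> in \<open>auto simp: orthogonal_basis_def subset_iff\<close>)
      also have "\<dots> = cinner x e" using Y \<open>e \<in> Y\<close> by (simp add: sum.delta)
      finally have "cinner (x - p) e = 0" by (simp add: cinner_diff_left)
      then show ?thesis by (simp add: cinner_eq_0_commute)
    qed
    have "Y \<subseteq> corthogonal_comp {x - p}" using orth by (auto simp: corthogonal_comp_def)
    then have sp: "complex_vector.span Y \<subseteq> corthogonal_comp {x - p}"
      using corthogonal_comp_closed_subspace
      by (intro complex_vector.span_minimal) (auto simp: csubspace_closed_def)
    have "p \<in> complex_vector.span Y" unfolding p_def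
      by (intro complex_vector.span_sum complex_vector.span_scale complex_vector.span_base)
    moreover have "y \<in> complex_vector.span Y" unfolding t(3)
      using t Y by (intro complex_vector.span_sum complex_vector.span_scale complex_vector.span_base) auto
    ultimately have "p - y \<in> corthogonal_comp {x - p}"
      using sp complex_vector.span_diff by blast
    then have "(p - y) \<bullet> (x - p) = 0" by (simp add: corthogonal_comp_def inner_eq_Re_cinner)
    then have "(norm (x - y))\<^sup>2 = (norm (x - p))\<^sup>2 + (norm (p - y))\<^sup>2"
      unfolding power2_norm_eq_inner by (simp add: algebra_simps inner_commute)
    then have "(norm (x - p))\<^sup>2 \<le> (norm (x - y))\<^sup>2" by simp
    then have "norm (x - p) \<le> norm (x - y)" by (simp add: power_mono_iff)
    then show ?thesis using y(2) by (simp add: dist_norm norm_minus_commute p_def)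
  qed
  then show "\<forall>\<^sub>F Y in finite_subsets_at_top E. dist (sum ?f Y) x < \<epsilon>"
    unfolding eventually_finite_subsets_at_top using t by blast
qed

text \<open>Conjugating the coefficients of finite sums of basis vectors is isometric, because the Gram
  matrix of the basis is real. Hence partial sums of the expansion of \<open>x\<close> go to a Cauchy sequence,
  and its limit has the conjugated coefficients.\<close>

lemma conjugation_coeff:
  assumes E: "orthogonal_basis E" and e: "e \<in> E"
  shows "cinner (conjugation E x) e = cnj (cinner x e)"
proof -
  define c where "c e = cinner x e / cinner e e" for e
  define f where "f F = (\<Sum>e\<in>F. c e *\<^sub>C e)" for F
  define g where "g F = (\<Sum>e\<in>F. cnj (c e) *\<^sub>C e)" for F
  have real: "cnj (cinner e e') = cinner e e'" if "e \<in> E" "e' \<in> E" for e e'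
    by (cases "e = e'") (use that E in \<open>auto simp: orthogonal_basis_def cinner_self\<close>)
  have gf: "cinner (g F) (g G) = cnj (cinner (f F) (f G))" if "F \<subseteq> E" "G \<subseteq> E" for F G
    unfolding f_def g_def cinner_sum_left cinner_sum_right cnj_sum
    by (intro sum.cong) (use that in \<open>auto simp: subset_iff real\<close>)
  have gf1: "cinner (g F) e = cnj (cinner (f F) e)" if "F \<subseteq> E" "e \<in> E" for F e
    unfolding f_def g_def cinner_sum_left cnj_sum
    by (intro sum.cong) (use that in \<open>auto simp: subset_iff real\<close>)
  have dist: "dist (g F) (g G) = dist (f F) (f G)" if "F \<subseteq> E" "G \<subseteq> E" for F G
  proof -
    have "cinner (g F - g G) (g F - g G) = cnj (cinner (f F - f G) (f F - f G))"
      by (simp add: cinner_diff_left cinner_diff_right gf that)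
    then have "cinner (g F - g G) (g F - g G) = cinner (f F - f G) (f F - f G)"
      by (simp add: cinner_self)
    then show ?thesis by (simp add: dist_norm norm_eq_iff_cinner)
  qed
  have sum_x: "((\<lambda>e. c e *\<^sub>C e) has_sum x) E" unfolding c_def by (rule basis_expansion[OF E])
  have "\<exists>F. finite F \<and> F \<subseteq> E \<and> dist (f F) x \<le> 1 / Suc n" for n
    unfolding f_def by (rule has_sum_finite_approximation[OF sum_x]) simp
  then obtain F where F: "\<And>n. F n \<subseteq> E" "\<And>n. dist (f (F n)) x \<le> 1 / Suc n" by metis
  have lim: "(\<lambda>n. f (F n)) \<longlonglongrightarrow> x"
  proof (rule metric_tendsto_imp_tendsto)
    show "(\<lambda>n. 1 / real (Suc n)) \<longlonglongrightarrow> 0"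
      using LIMSEQ_inverse_real_of_nat by (simp add: inverse_eq_divide)
  qed (use F in \<open>auto intro!: always_eventually simp: dist_real_def\<close>)
  then have "Cauchy (\<lambda>n. f (F n))" by (rule LIMSEQ_imp_Cauchy)
  then have "Cauchy (\<lambda>n. g (F n))" unfolding Cauchy_def by (simp add: dist F)
  then obtain w where w: "(\<lambda>n. g (F n)) \<longlonglongrightarrow> w" using Cauchy_convergent convergent_def by blast
  have coeff: "cinner w e = cnj (cinner x e)" if "e \<in> E" for e
  proof (rule LIMSEQ_unique)
    show "(\<lambda>n. cinner (g (F n)) e) \<longlonglongrightarrow> cinner w e" by (rule tendsto_cinner_left[OF w])
    have "(\<lambda>n. cnj (cinner (f (F n)) e)) \<longlonglongrightarrow> cnj (cinner x e)"
      by (intro tendsto_cnj tendsto_cinner_left lim)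
    then show "(\<lambda>n. cinner (g (F n)) e) \<longlonglongrightarrow> cnj (cinner x e)" by (simp add: gf1 F that)
  qed
  have "((\<lambda>e. cnj (c e) *\<^sub>C e) has_sum w) E"
    using basis_expansion[OF E, of w]
    by (rule has_sum_cong[THEN iffD1, rotated]) (simp add: coeff c_def real)
  then have "conjugation E x = w" unfolding conjugation_def c_def by (rule infsumI)
  then show ?thesis using coeff[OF e] by simp
qed

text \<open>All of this is read off from the coefficients; the inner product is the sum of the products of
  coefficients, and conjugation passes through the sum.\<close>

lemma conjugation_props:
  assumes E: "orthogonal_basis E"
  defines "J \<equiv> conjugation E"
  shows "J (x + y) = J x + J y" "J (c *\<^sub>C x) = cnj c *\<^sub>C J x" "J (J x) = x"
    "cinner (J x) (J y) = cnj (cinner x y)"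
proof -
  note co = conjugation_coeff[OF E, folded J_def]
  show "J (x + y) = J x + J y"
    by (rule orthogonal_basis_eqI[OF E]) (simp add: co cinner_add_left)
  show "J (c *\<^sub>C x) = cnj c *\<^sub>C J x" by (rule orthogonal_basis_eqI[OF E]) (simp add: co)
  show "J (J x) = x" by (rule orthogonal_basis_eqI[OF E]) (simp add: co)
  have exp: "((\<lambda>e. cinner x e / cinner e e * cinner e y) has_sum cinner x y) E" for x y
    using has_sum_bounded_linear[OF bounded_linear_cinner_left[of y] basis_expansion[OF E, of x]] by simp
  have "((\<lambda>e. cnj (cinner x e / cinner e e * cinner e y)) has_sum cinner (J x) (J y)) E"
  proof (rule has_sum_cong[THEN iffD1, rotated, OF exp])
    fix e assume "e \<in> E"
    then have "cinner e (J y) = cinner y e" by (metis co cinner_commute complex_cnj_cnj)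
    then show "cinner (J x) e / cinner e e * cinner e (J y) = cnj (cinner x e / cinner e e * cinner e y)"
      using co[OF \<open>e \<in> E\<close>] cinner_commute[of y e] cinner_commute[of e e] by simp
  qed
  moreover have "((\<lambda>e. cnj (cinner x e / cinner e e * cinner e y)) has_sum cnj (cinner x y)) E"
    using exp[of x y] by (simp only: has_sum_cnj_iff)
  ultimately show "cinner (J x) (J y) = cnj (cinner x y)" by (rule has_sum_unique)
qed

lemma norm_conjugation:
  assumes "orthogonal_basis E"
  shows "norm (conjugation E x) = norm x"
proof -
  have "cinner (conjugation E x) (conjugation E x) = cnj (cinner x x)"
    by (rule conjugation_props(4)[OF assms])
  also have "\<dots> = cinner x x" by (simp add: cinner_self)
  finally show ?thesis unfolding norm_eq_iff_cinner .
qed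

section \<open>Vectors orthogonal to two given ones\<close>

text \<open>The Gram-Schmidt process for \<open>a\<close>, \<open>b\<close>. Linear dependence does no harm: a vanishing vector gets the
  coefficient \<open>0\<close>, since division by zero yields zero.\<close>

lemma gram_schmidt_two: "\<exists>\<alpha> \<beta>. cinner (v - (\<alpha> *\<^sub>C a + \<beta> *\<^sub>C b)) a = 0 \<and> cinner (v - (\<alpha> *\<^sub>C a + \<beta> *\<^sub>C b)) b = 0"
proof -
  define k where "k = cinner b a / cinner a a"
  define b' where "b' = b - k *\<^sub>C a"
  define \<alpha> where "\<alpha> = cinner v a / cinner a a"
  define \<beta> where "\<beta> = cinner v b' / cinner b' b'"
  define z where "z = v - \<alpha> *\<^sub>C a - \<beta> *\<^sub>C b'"
  have ba: "cinner b' a = 0" by (cases "a = 0") (simp_all add: b'_def k_def cinner_diff_left)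
  then have ab: "cinner a b' = 0" by (simp add: cinner_eq_0_commute)
  have za: "cinner z a = 0"
    by (cases "a = 0") (simp_all add: z_def cinner_diff_left ba \<alpha>_def)
  have zb': "cinner z b' = 0"
    by (cases "b' = 0") (simp_all add: z_def cinner_diff_left ab \<beta>_def)
  have "cinner z b = 0"
    using zb' za by (simp add: b'_def cinner_diff_right)
  moreover have "z = v - ((\<alpha> - \<beta> * k) *\<^sub>C a + \<beta> *\<^sub>C b)"
    by (simp add: z_def b'_def algebra_simps complex_vector.scale_left_diff_distrib
        complex_vector.scale_right_diff_distrib)
  ultimately show ?thesis using za by blast
qed

text \<open>The residual of \<open>v\<close> over \<open>x\<close> and \<open>y\<close> is orthogonal to both, hence to \<open>v\<close>, hence to itself. This is what
  allows linear dependence to be expressed by orthogonality alone.\<close>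

lemma double_perp_two:
  assumes "\<And>z. cinner x z = 0 \<Longrightarrow> cinner y z = 0 \<Longrightarrow> cinner v z = 0"
  shows "\<exists>\<alpha> \<beta>. v = \<alpha> *\<^sub>C x + \<beta> *\<^sub>C y"
proof -
  obtain \<alpha> \<beta> where z: "cinner (v - (\<alpha> *\<^sub>C x + \<beta> *\<^sub>C y)) x = 0" "cinner (v - (\<alpha> *\<^sub>C x + \<beta> *\<^sub>C y)) y = 0"
    using gram_schmidt_two by blast
  define z where "z = v - (\<alpha> *\<^sub>C x + \<beta> *\<^sub>C y)"
  have xy: "cinner x z = 0" "cinner y z = 0" using z by (simp_all add: z_def cinner_eq_0_commute)
  then have "cinner z z = 0"
    using assms[OF xy] by (subst z_def) (simp add: cinner_expand)
  then have "z = 0" by simp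
  then show ?thesis unfolding z_def by auto
qed

text \<open>Otherwise \<open>a\<close> and \<open>b\<close> would span the space, although three orthogonal vectors are independent.\<close>

lemma exists_orthogonal_to_two:
  fixes a b :: "'a::complex_hilbert"
  assumes E: "orthogonal_basis (E :: 'a set)" and dim: "infinite E \<or> card E \<ge> 3"
  shows "\<exists>c. c \<noteq> 0 \<and> cinner c a = 0 \<and> cinner c b = 0"
proof (rule ccontr)
  assume not: "\<not> ?thesis"
  have "v \<in> complex_vector.span {a, b}" for v
  proof -
    obtain \<alpha> \<beta> where "v - (\<alpha> *\<^sub>C a + \<beta> *\<^sub>C b) = 0"
      using gram_schmidt_two[of v a b] not by blast
    then have "v = \<alpha> *\<^sub>C a + \<beta> *\<^sub>C b" by simp
    then show ?thesis
      by (simp add: complex_vector.span_add complex_vector.span_scale complex_vector.span_base)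
  qed
  then have span: "T \<subseteq> complex_vector.span {a, b}" for T by blast
  obtain T where T: "finite T" "card T = 3" "T \<subseteq> E"
    by (metis dim infinite_arbitrarily_large obtain_subset_with_card_n)
  have "complex_vector.independent T"
  proof (rule complex_vector.independent_if_scalars_zero[OF T(1)])
    fix f x assume sum: "(\<Sum>x\<in>T. f x *\<^sub>C x) = 0" and x: "x \<in> T"
    have "0 = cinner (\<Sum>x\<in>T. f x *\<^sub>C x) x" by (simp add: sum)
    also have "\<dots> = (\<Sum>y\<in>T. f y * cinner y x)" by (simp add: cinner_sum_left)
    also have "\<dots> = (\<Sum>y\<in>T. if y = x then f x * cinner x x else 0)"
      by (rule sum.cong) (use E T x in \<open>auto simp: orthogonal_basis_def subset_iff\<close>)
    also have "\<dots> = f x * cinner x x" using T x by simp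
    finally show "f x = 0" using E T x by (auto simp: orthogonal_basis_def)
  qed
  then have "card T \<le> card {a, b}"
    using complex_vector.independent_span_bound[OF _ _ span[of T]] by simp
  also have "card {a, b} \<le> 2" by (simp add: card_insert_if)
  finally show False using T by simp
qed

section \<open>Orthogonality preserving maps of rays\<close>

text \<open>A map of rays is represented by a map \<open>\<phi>\<close> of vectors that picks some vector of the image ray, so
  every statement about \<open>\<phi>\<close> is up to scalars. The unit vectors \<open>e\<close> and \<open>u\<close> serve as coordinates: \<open>e\<close> fixes
  the affine chart \<open>e + e\<^sup>\<bottom>\<close> of the rays, and multiples of \<open>u\<close> parametrise the scalars.\<close>

locale ray_orthogonality =
  fixes \<phi> :: "'a::complex_hilbert \<Rightarrow> 'a" and e u :: 'a
  assumes orth: "cinner (\<phi> x) (\<phi> y) = 0 \<longleftrightarrow> cinner x y = 0"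
    and onto: "\<exists>x c. y = c *\<^sub>C \<phi> x"
    and dim3: "\<exists>c :: 'a. c \<noteq> 0 \<and> cinner c a = 0 \<and> cinner c b = 0"
    and e: "cinner e e = 1" and u: "cinner u u = 1" "cinner u e = 0"
begin

definition e' :: 'a where "e' = \<phi> e /\<^sub>R norm (\<phi> e)"

text \<open>The map \<open>\<phi>\<close> in the affine charts: \<open>e' + S x\<close> is the point of \<open>e' + e'\<^sup>\<bottom>\<close> on the ray of \<open>\<phi> (e + x)\<close>.\<close>

definition S :: "'a \<Rightarrow> 'a" where "S x = (1 / cinner (\<phi> (e + x)) e') *\<^sub>C \<phi> (e + x) - e'"

lemma phi_eq_0: "\<phi> x = 0 \<longleftrightarrow> x = 0"
  using orth[of x x] by simp

text \<open>Planes go to planes, as a plane is the set of vectors orthogonal to everything that is orthogonal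
  to two of its vectors.\<close>

lemma phi_span:
  assumes "v = a *\<^sub>C x + b *\<^sub>C y" shows "\<exists>c d. \<phi> v = c *\<^sub>C \<phi> x + d *\<^sub>C \<phi> y"
proof (rule double_perp_two)
  fix z assume z: "cinner (\<phi> x) z = 0" "cinner (\<phi> y) z = 0"
  obtain w c where w: "z = c *\<^sub>C \<phi> w" using onto by blast
  show "cinner (\<phi> v) z = 0"
  proof (cases "c = 0")
    case False
    then have "cinner x w = 0" "cinner y w = 0" using z orth by (simp_all add: w)
    then have "cinner v w = 0" by (simp add: assms cinner_add_left)
    then show ?thesis using orth by (simp add: w)
  qed (simp add: w)
qed

lemma e_nz: "e \<noteq> 0" using e by auto

lemma phi_e: "\<phi> e = complex_of_real (norm (\<phi> e)) *\<^sub>C e'" "norm (\<phi> e) \<noteq> 0"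
  using e_nz by (simp_all add: e'_def scaleC_of_real phi_eq_0)

lemma e'_unit: "cinner e' e' = 1"
proof -
  have "norm e' = 1" using phi_e(2) by (simp add: e'_def)
  then show ?thesis by (simp add: cinner_self)
qed

lemma phi_e'_iff: "cinner (\<phi> x) e' = 0 \<longleftrightarrow> cinner x e = 0"
  using orth[of x e] phi_e(2) by (simp add: e'_def)

lemma phi_affine:
  assumes "cinner x e = 0"
  shows "\<exists>k. k \<noteq> 0 \<and> \<phi> (e + x) = k *\<^sub>C (e' + S x)" and "cinner (S x) e' = 0"
proof -
  have "cinner (e + x) e \<noteq> 0" using assms e by (simp add: cinner_add_left)
  then have nz: "cinner (\<phi> (e + x)) e' \<noteq> 0" by (simp add: phi_e'_iff)
  then show "\<exists>k. k \<noteq> 0 \<and> \<phi> (e + x) = k *\<^sub>C (e' + S x)"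
    by (intro exI[of _ "cinner (\<phi> (e + x)) e'"]) (simp add: S_def)
  show "cinner (S x) e' = 0" using nz e'_unit by (simp add: S_def cinner_diff_left)
qed

lemma S_e' [simp]: "cinner x e = 0 \<Longrightarrow> cinner (S x) e' = 0" "cinner x e = 0 \<Longrightarrow> cinner e' (S x) = 0"
  using phi_affine(2) by (simp_all add: cinner_eq_0_commute[of e'])

lemma S_zero [simp]: "S 0 = 0"
proof -
  obtain k where k: "k \<noteq> 0" "\<phi> e = k *\<^sub>C (e' + S 0)"
    using phi_affine(1)[of 0] by (auto simp del: norm_scaleC)
  have eq: "k *\<^sub>C (e' + S 0) = complex_of_real (norm (\<phi> e)) *\<^sub>C e'"
    using phi_e(1) unfolding k(2)[symmetric] .
  then have "cinner (k *\<^sub>C (e' + S 0)) e' = cinner (complex_of_real (norm (\<phi> e)) *\<^sub>C e') e'"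
    by (rule arg_cong)
  then have "k = complex_of_real (norm (\<phi> e))" by (simp add: cinner_add_left e'_unit)
  then show ?thesis using eq k(1) by simp
qed

text \<open>Both sides say that \<open>e + x\<close> and \<open>e + y\<close>, respectively their images, are orthogonal.\<close>

lemma S_minus_one:
  assumes "cinner x e = 0" "cinner y e = 0"
  shows "cinner (S x) (S y) = -1 \<longleftrightarrow> cinner x y = -1"
proof -
  obtain k l where k: "k \<noteq> 0" "\<phi> (e + x) = k *\<^sub>C (e' + S x)" and l: "l \<noteq> 0" "\<phi> (e + y) = l *\<^sub>C (e' + S y)"
    using phi_affine(1) assms by meson
  have ey: "cinner e y = 0" using assms by (simp add: cinner_eq_0_commute)
  have "cinner (e + x) (e + y) = 0 \<longleftrightarrow> cinner (e' + S x) (e' + S y) = 0"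
    using orth[of "e + x" "e + y"] k l by simp
  then have "1 + cinner x y = 0 \<longleftrightarrow> 1 + cinner (S x) (S y) = 0"
    using assms by (simp add: cinner_add_left cinner_add_right e e'_unit ey)
  then show ?thesis by (metis add.inverse_unique add.right_inverse)
qed

text \<open>A vector \<open>x\<close> of \<open>e\<^sup>\<bottom>\<close> is the direction at infinity of the plane through \<open>e\<close> and \<open>e + x\<close>; its image lies
  in the image of this plane and in \<open>e'\<^sup>\<bottom>\<close>, so \<open>S\<close> represents \<open>\<phi>\<close> at infinity as well.\<close>

lemma phi_S:
  assumes "cinner x e = 0"
  shows "\<exists>c. \<phi> x = c *\<^sub>C S x"
proof -
  have "x = 1 *\<^sub>C (e + x) + (-1) *\<^sub>C e" by simp
  then obtain c d where cd: "\<phi> x = c *\<^sub>C \<phi> (e + x) + d *\<^sub>C \<phi> e" using phi_span by blast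
  obtain k where k: "\<phi> (e + x) = k *\<^sub>C (e' + S x)" using phi_affine(1)[OF assms] by blast
  define r where "r = complex_of_real (norm (\<phi> e))"
  have eq: "\<phi> x = (c * k) *\<^sub>C (e' + S x) + (d * r) *\<^sub>C e'"
    unfolding cd k by (subst phi_e(1)) (simp add: r_def)
  have "cinner (\<phi> x) e' = 0" using assms by (simp add: phi_e'_iff)
  then have "c * k + d * r = 0" unfolding eq by (simp add: cinner_add_left e'_unit assms)
  then have "d * r = - (c * k)" by (simp add: eq_neg_iff_add_eq_0 add.commute)
  then have "\<phi> x = (c * k) *\<^sub>C S x"
    unfolding eq by (simp add: scaleC_add_right del: complex_vector.scale_scale)
  then show ?thesis by blast
qed

lemma S_orth:
  assumes "cinner x e = 0" "cinner y e = 0"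
  shows "cinner (S x) (S y) = 0 \<longleftrightarrow> cinner x y = 0"
proof (cases "x = 0 \<or> y = 0")
  case False
  obtain c d where c: "\<phi> x = c *\<^sub>C S x" and d: "\<phi> y = d *\<^sub>C S y" using phi_S assms by blast
  then have "c \<noteq> 0" "d \<noteq> 0" using False phi_eq_0 by force+
  then show ?thesis using orth[of x y] c d by simp
qed auto

text \<open>Affine lines go to affine lines with the image direction.\<close>

lemma S_span:
  assumes x: "cinner x e = 0" and y: "cinner y e = 0"
  shows "\<exists>d. S (x + a *\<^sub>C y) = S x + d *\<^sub>C S y"
proof -
  have "e + (x + a *\<^sub>C y) = 1 *\<^sub>C (e + x) + a *\<^sub>C y" by simp
  then obtain c d where cd: "\<phi> (e + (x + a *\<^sub>C y)) = c *\<^sub>C \<phi> (e + x) + d *\<^sub>C \<phi> y"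
    using phi_span by blast
  have xy: "cinner (x + a *\<^sub>C y) e = 0" using x y by (simp add: cinner_add_left)
  obtain k where k: "k \<noteq> 0" "\<phi> (e + (x + a *\<^sub>C y)) = k *\<^sub>C (e' + S (x + a *\<^sub>C y))"
    using phi_affine(1)[OF xy] by blast
  obtain l where l: "\<phi> (e + x) = l *\<^sub>C (e' + S x)" using phi_affine(1)[OF x] by blast
  obtain m where m: "\<phi> y = m *\<^sub>C S y" using phi_S[OF y] by blast
  have eq: "k *\<^sub>C (e' + S (x + a *\<^sub>C y)) = (c * l) *\<^sub>C (e' + S x) + (d * m) *\<^sub>C S y"
    using cd unfolding k l m by simp
  then have "cinner (k *\<^sub>C (e' + S (x + a *\<^sub>C y))) e' = cinner ((c * l) *\<^sub>C (e' + S x) + (d * m) *\<^sub>C S y) e'"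
    by simp
  then have kcl: "k = c * l" by (simp add: cinner_add_left e'_unit x y xy)
  have "k *\<^sub>C S (x + a *\<^sub>C y) = k *\<^sub>C S x + (d * m) *\<^sub>C S y"
    using eq unfolding kcl[symmetric] by (simp add: scaleC_add_right)
  then have "(1/k) *\<^sub>C k *\<^sub>C S (x + a *\<^sub>C y) = (1/k) *\<^sub>C (k *\<^sub>C S x + (d * m) *\<^sub>C S y)" by simp
  then have "S (x + a *\<^sub>C y) = S x + (d * m / k) *\<^sub>C S y"
    using \<open>k \<noteq> 0\<close> by (simp add: scaleC_add_right)
  then show ?thesis by blast
qed

text \<open>The point \<open>x + y\<close> lies on the line through \<open>x\<close> in direction \<open>y\<close> and on the line through \<open>y\<close> in direction
  \<open>x\<close>. The vector \<open>z\<close> tells the two image directions apart, so the image lines meet only in \<open>S x + S y\<close>.\<close>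

lemma S_add_witness:
  assumes x: "cinner x e = 0" and y: "cinner y e = 0" and z: "cinner z e = 0"
    and xz: "cinner x z = 0" and yz: "cinner y z \<noteq> 0"
  shows "S (x + y) = S x + S y"
proof -
  obtain d where d: "S (x + y) = S x + d *\<^sub>C S y" using S_span[OF x y, of 1] by auto
  obtain d' where d': "S (x + y) = S y + d' *\<^sub>C S x"
    using S_span[OF y x, of 1] by (auto simp: add.commute)
  have "cinner (S x + d *\<^sub>C S y) (S z) = cinner (S y + d' *\<^sub>C S x) (S z)" using d d' by simp
  moreover have "cinner (S x) (S z) = 0" "cinner (S y) (S z) \<noteq> 0"
    using S_orth[OF x z] S_orth[OF y z] xz yz by auto
  ultimately have "d = 1" by (simp add: cinner_add_left)
  then show ?thesis using d by simp
qed

text \<open>The component of \<open>y\<close> orthogonal to \<open>x\<close> is a witness.\<close>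

lemma S_add_indep:
  assumes x: "cinner x e = 0" and y: "cinner y e = 0" and ind: "\<And>a. y \<noteq> a *\<^sub>C x"
  shows "S (x + y) = S x + S y"
proof -
  define z where "z = y - (cinner y x / cinner x x) *\<^sub>C x"
  have zx: "cinner z x = 0" by (cases "x = 0") (simp_all add: z_def cinner_diff_left)
  have "z \<noteq> 0" using ind by (simp add: z_def)
  have "cinner z (z + (cinner y x / cinner x x) *\<^sub>C x) = cinner z z"
    by (simp add: cinner_add_right zx)
  moreover have "z + (cinner y x / cinner x x) *\<^sub>C x = y" by (simp add: z_def)
  ultimately have "cinner z y = cinner z z" by (simp only:)
  then have "cinner y z \<noteq> 0" using \<open>z \<noteq> 0\<close> cinner_eq_0_commute[of y z] by simp
  moreover have "cinner z e = 0" using x y by (simp add: z_def cinner_diff_left)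
  ultimately show ?thesis using S_add_witness[OF x y _ cinner_eq_0_sym[OF zx]] by simp
qed

lemma S_add:
  assumes x: "cinner x e = 0" and y: "cinner y e = 0"
  shows "S (x + y) = S x + S y"
proof (cases "x \<noteq> 0 \<and> (\<exists>a. y = a *\<^sub>C x)")
  case True
  then obtain a where a: "y = a *\<^sub>C x" "x \<noteq> 0" by blast
  (* Here the third dimension enters: w is off the common line of x and y, so additivity holds for
     the pairs (x + y, w), (x, y + w) and (y, w). *)
  obtain w where w: "w \<noteq> 0" "cinner w x = 0" "cinner w e = 0" using dim3[of x e] by blast
  have wx: "w \<noteq> b *\<^sub>C x" for b using w by auto
  have "S (x + y + w) = S (x + y) + S w"
  proof (rule S_add_indep)
    show "w \<noteq> b *\<^sub>C (x + y)" for b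
      using wx[of "b * (1 + a)"] by (simp add: a complex_vector.scale_left_distrib scaleC_add_right ring_distribs)
  qed (use x y w in \<open>simp_all add: cinner_add_left\<close>)
  moreover have "S (x + (y + w)) = S x + S (y + w)"
  proof (rule S_add_indep)
    show "y + w \<noteq> b *\<^sub>C x" for b
    proof
      assume "y + w = b *\<^sub>C x"
      then have "w = (b - a) *\<^sub>C x"
        by (simp add: a complex_vector.scale_left_diff_distrib eq_diff_eq add.commute)
      then show False using wx by blast
    qed
  qed (use x y w in \<open>simp_all add: cinner_add_left\<close>)
  moreover have "S (y + w) = S y + S w"
  proof (rule S_add_indep)
    show "w \<noteq> b *\<^sub>C y" for b using wx[of "b * a"] by (simp add: a)
  qed (use x y w in simp_all)
  ultimately have "S (x + y) + S w = (S x + S y) + S w" by (simp only: add.assoc)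
  then show ?thesis by (simp only: add_right_cancel)
next
  case False
  show ?thesis
  proof (cases "x = 0")
    case True
    then show ?thesis by simp
  next
    case nz: False
    show ?thesis by (rule S_add_indep[OF x y]) (use False nz in blast)
  qed
qed

lemma S_minus:
  assumes "cinner x e = 0" shows "S (- x) = - S x"
  using S_add[of x "- x"] assms by (simp add: eq_neg_iff_add_eq_0 add.commute)

lemma S_line:
  assumes "cinner x e = 0" shows "\<exists>k. S (l *\<^sub>C x) = k *\<^sub>C S x"
  using S_span[of 0 x l] assms by simp

lemma S_u: "cinner (S u) (S u) = 1"
proof -
  have "cinner (S u) (S (- u)) = -1" using u by (subst S_minus_one) auto
  then show ?thesis using S_minus[of u] u by simp
qed

definition \<sigma> :: "complex \<Rightarrow> complex" where "\<sigma> l = cinner (S (l *\<^sub>C u)) (S u)"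

lemma S_scale_u: "S (l *\<^sub>C u) = \<sigma> l *\<^sub>C S u"
proof -
  obtain k where "S (l *\<^sub>C u) = k *\<^sub>C S u" using S_line u by blast
  then show ?thesis by (simp add: \<sigma>_def S_u)
qed

text \<open>Comparing the multiples of \<open>x + y\<close> with those of \<open>x\<close> and of \<open>y\<close> shows that orthogonal vectors
  are stretched alike.\<close>

lemma S_scale_transfer:
  assumes x: "cinner x e = 0" and y: "cinner y e = 0" and xy: "cinner x y = 0" and "x \<noteq> 0"
    and k: "S (l *\<^sub>C x) = k *\<^sub>C S x"
  shows "S (l *\<^sub>C y) = k *\<^sub>C S y"
proof (cases "y = 0")
  case False
  obtain m where m: "S (l *\<^sub>C y) = m *\<^sub>C S y" using S_line y by blast
  obtain n where n: "S (l *\<^sub>C (x + y)) = n *\<^sub>C S (x + y)" using S_line[of "x + y"] x y by (auto simp: cinner_add_left)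
  have eq: "n *\<^sub>C S x + n *\<^sub>C S y = k *\<^sub>C S x + m *\<^sub>C S y"
    using n S_add[OF x y] S_add[of "l *\<^sub>C x" "l *\<^sub>C y"] k m x y by (simp add: scaleC_add_right)
  have o: "cinner (S x) (S y) = 0" "cinner (S y) (S x) = 0"
    using S_orth[OF x y] S_orth[OF y x] xy cinner_eq_0_commute[of x y] by auto
  have nz: "S x \<noteq> 0" "S y \<noteq> 0" using S_orth[OF x x] S_orth[OF y y] \<open>x \<noteq> 0\<close> False by auto
  have "cinner (n *\<^sub>C S x + n *\<^sub>C S y) (S x) = cinner (k *\<^sub>C S x + m *\<^sub>C S y) (S x)"
    "cinner (n *\<^sub>C S x + n *\<^sub>C S y) (S y) = cinner (k *\<^sub>C S x + m *\<^sub>C S y) (S y)" by (simp_all only: eq)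
  then have "n = k" "n = m" using nz by (simp_all add: cinner_add_left o)
  then show ?thesis using m by simp
qed simp

text \<open>Split \<open>x\<close> into a multiple of \<open>u\<close> and a vector orthogonal to \<open>u\<close>. The factor passes from \<open>u\<close> to the
  latter directly, and to the former by way of a vector \<open>v\<close> orthogonal to \<open>u\<close> and \<open>e\<close>.\<close>

lemma S_scale:
  assumes x: "cinner x e = 0"
  shows "S (l *\<^sub>C x) = \<sigma> l *\<^sub>C S x"
proof -
  have u0: "u \<noteq> 0" using u by auto
  obtain v where v: "v \<noteq> 0" "cinner v u = 0" "cinner v e = 0" using dim3[of u e] by blast
  have "S (l *\<^sub>C v) = \<sigma> l *\<^sub>C S v"
    by (rule S_scale_transfer[OF u(2) v(3) _ u0 S_scale_u]) (rule cinner_eq_0_sym[OF v(2)])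
  then have 1: "S (l *\<^sub>C a *\<^sub>C u) = \<sigma> l *\<^sub>C S (a *\<^sub>C u)" for a
    by (rule S_scale_transfer[OF v(3) _ _ v(1), rotated 2]) (simp_all add: u v)
  define a where "a = cinner x u"
  define w where "w = x - a *\<^sub>C u"
  have w: "cinner w e = 0" "cinner w u = 0" "cinner u w = 0"
  proof -
    show "cinner w e = 0" using x u by (simp add: w_def cinner_diff_left)
    show "cinner w u = 0" using u by (simp add: w_def a_def cinner_diff_left)
    then show "cinner u w = 0" by (simp add: cinner_eq_0_commute)
  qed
  have 2: "S (l *\<^sub>C w) = \<sigma> l *\<^sub>C S w"
    by (rule S_scale_transfer[OF u(2) w(1) w(3) u0 S_scale_u])
  have xe: "x = a *\<^sub>C u + w" by (simp add: w_def)
  have "S x = S (a *\<^sub>C u) + S w" unfolding xe using u w by (intro S_add) auto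
  moreover have "S (l *\<^sub>C x) = S (l *\<^sub>C a *\<^sub>C u) + S (l *\<^sub>C w)"
    unfolding xe scaleC_add_right using u w by (intro S_add) auto
  ultimately show ?thesis using 1 2 by (simp add: scaleC_add_right)
qed

lemma sigma_add: "\<sigma> (a + b) = \<sigma> a + \<sigma> b"
  using S_add[of "a *\<^sub>C u" "b *\<^sub>C u"] u by (simp add: \<sigma>_def scaleC_add_left cinner_add_left)

lemma sigma_mult: "\<sigma> (a * b) = \<sigma> a * \<sigma> b"
proof -
  have "S ((a * b) *\<^sub>C u) = \<sigma> a *\<^sub>C S (b *\<^sub>C u)"
    using S_scale[of "b *\<^sub>C u" a] u by simp
  then show ?thesis by (simp add: \<sigma>_def)
qed

lemma sigma_one: "\<sigma> 1 = 1"
  by (simp add: \<sigma>_def S_u)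

lemma sigma_zero: "\<sigma> 0 = 0"
  by (simp add: \<sigma>_def)

lemma sigma_minus: "\<sigma> (- a) = - \<sigma> a"
  using sigma_add[of a "- a"] sigma_zero by (simp add: eq_neg_iff_add_eq_0 add.commute)

text \<open>Scaling \<open>y\<close> so that the inner product becomes \<open>-1\<close> determines \<open>cinner (S x) (S y)\<close>.\<close>

lemma S_cinner_aux:
  assumes x: "cinner x e = 0" and y: "cinner y e = 0"
  shows "cinner (S x) (S y) = cnj (\<sigma> (cnj (cinner x y)))"
proof (cases "cinner x y = 0")
  case True
  then show ?thesis using S_orth[OF x y] sigma_zero by simp
next
  case False
  define c where "c = cnj (cinner x y)"
  have c0: "c \<noteq> 0" using False by (simp add: c_def)
  have "cinner x ((- 1 / c) *\<^sub>C y) = -1" using c0 by (simp add: c_def)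
  then have "cinner (S x) (S ((- 1 / c) *\<^sub>C y)) = -1"
    using x y by (subst S_minus_one) auto
  then have 1: "cnj (\<sigma> (- 1 / c)) * cinner (S x) (S y) = - 1"
    unfolding S_scale[OF y] cinner_scaleC_right .
  have "\<sigma> (- 1 / c) * \<sigma> c = - 1"
    using c0 by (simp add: sigma_mult[symmetric] sigma_minus sigma_one)
  then have "cnj (\<sigma> (- 1 / c) * \<sigma> c) = cnj (- 1)" by (rule arg_cong)
  then have "cnj (\<sigma> (- 1 / c)) * cnj (\<sigma> c) = cnj (\<sigma> (- 1 / c)) * cinner (S x) (S y)"
    unfolding 1 complex_cnj_mult by simp
  moreover have "cnj (\<sigma> (- 1 / c)) \<noteq> 0" using 1 by auto
  ultimately have "cnj (\<sigma> c) = cinner (S x) (S y)" by (simp only: mult_cancel_left) blast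
  then show ?thesis unfolding c_def[symmetric] by (rule sym)
qed

text \<open>\<open>\<sigma> a\<close> is the inner product of \<open>S (a *\<^sub>C u)\<close> and \<open>S u\<close>, for which the previous formula gives a second
  value.\<close>

lemma sigma_cnj: "\<sigma> (cnj a) = cnj (\<sigma> a)"
proof -
  have "\<sigma> a = cnj (\<sigma> (cnj a))"
    using S_cinner_aux[of "a *\<^sub>C u" u] u by (simp add: \<sigma>_def[symmetric])
  then have "cnj (\<sigma> a) = cnj (cnj (\<sigma> (cnj a)))" by (rule arg_cong)
  then show ?thesis by simp
qed

lemma S_cinner:
  assumes "cinner x e = 0" "cinner y e = 0"
  shows "cinner (S x) (S y) = \<sigma> (cinner x y)"
  using S_cinner_aux[OF assms] by (simp add: sigma_cnj)

text \<open>Commuting with conjugation, \<open>\<sigma>\<close> maps reals to reals. It maps squares to squares, so it is monotone on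
  the reals; being additive with \<open>\<sigma> 1 = 1\<close>, it fixes every real number. Only the image of \<open>\<i>\<close> is left
  open.\<close>

lemma sigma_of_real: "\<sigma> (complex_of_real r) = complex_of_real r"
proof -
  define s where "s r = Re (\<sigma> (complex_of_real r))" for r
  have sr: "\<sigma> (complex_of_real r) = complex_of_real (s r)" for r
    using sigma_cnj[of "complex_of_real r"] by (simp add: s_def complex_eq_iff)
  have add: "s (a + b) = s a + s b" for a b by (simp add: s_def sigma_add)
  have neg: "s (- a) = - s a" for a by (simp add: s_def sigma_minus)
  have pos: "s a \<ge> 0" if "a \<ge> 0" for a
  proof -
    have "\<sigma> (complex_of_real a) = \<sigma> (complex_of_real (sqrt a)) * \<sigma> (complex_of_real (sqrt a))"
      unfolding sigma_mult[symmetric] of_real_mult[symmetric] using that by simp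
    then have "complex_of_real (s a) = complex_of_real (s (sqrt a) * s (sqrt a))" by (simp add: sr)
    then have "s a = s (sqrt a) * s (sqrt a)" by (simp only: of_real_eq_iff)
    then show ?thesis by simp
  qed
  have mono: "s a \<le> s b" if "a \<le> b" for a b
    using pos[of "b - a"] add[of a "b - a"] that by simp
  have one: "s 1 = 1" by (simp add: s_def sigma_one)
  have zero: "s 0 = 0" by (simp add: s_def sigma_zero)
  have nat_mult: "s (of_nat n * a) = of_nat n * s a" for n a
    by (induction n) (simp_all add: zero add distrib_right)
  have int_eq: "s (of_int k) = of_int k" for k
  proof (cases k)
    case (nonneg n) then show ?thesis using nat_mult[of n 1] one by simp
  next
    case (neg n) then show ?thesis using nat_mult[of "Suc n" 1] one \<open>\<And>a. s (- a) = - s a\<close>[of "of_nat (Suc n)"] by simp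
  qed
  (* Squeeze n * r between consecutive integers, which s fixes. *)
  have bound: "of_nat n * \<bar>s r - r\<bar> \<le> 1" for n
  proof -
    let ?k = "\<lfloor>of_nat n * r\<rfloor>"
    have "s (of_int ?k) \<le> s (of_nat n * r)" "s (of_nat n * r) \<le> s (of_int (?k + 1))"
      by (intro mono; linarith)+
    then have "of_int ?k \<le> of_nat n * s r" "of_nat n * s r \<le> of_int (?k + 1)"
      unfolding int_eq nat_mult .
    then have "\<bar>of_nat n * s r - of_nat n * r\<bar> \<le> 1" by linarith
    then show ?thesis by (simp add: right_diff_distrib[symmetric] abs_mult)
  qed
  have "s r = r"
  proof (rule ccontr)
    assume "s r \<noteq> r"
    then obtain n where "1 < of_nat n * \<bar>s r - r\<bar>" using reals_Archimedean3[of "\<bar>s r - r\<bar>"] by auto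
    then show False using bound[of n] by simp
  qed
  then show ?thesis using sr by simp
qed

lemma sigma_cases: "\<sigma> = id \<or> \<sigma> = cnj"
proof -
  have "\<sigma> \<i> * \<sigma> \<i> = - 1" by (simp add: sigma_mult[symmetric] sigma_minus sigma_one)
  then have "(\<sigma> \<i> - \<i>) * (\<sigma> \<i> + \<i>) = 0" by (simp add: algebra_simps)
  then have i: "\<sigma> \<i> = \<i> \<or> \<sigma> \<i> = - \<i>" by (simp add: eq_neg_iff_add_eq_0)
  have eq: "\<sigma> z = complex_of_real (Re z) + \<sigma> \<i> * complex_of_real (Im z)" for z
  proof -
    have "\<sigma> z = \<sigma> (complex_of_real (Re z) + \<i> * complex_of_real (Im z))" by (simp add: complex_eq[symmetric])
    then show ?thesis by (simp add: sigma_add sigma_mult sigma_of_real)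
  qed
  from i show ?thesis
  proof
    assume i: "\<sigma> \<i> = \<i>"
    have "\<sigma> = id" by (rule ext) (simp add: eq[unfolded i] complex_eq_iff)
    then show ?thesis ..
  next
    assume i: "\<sigma> \<i> = - \<i>"
    have "\<sigma> = cnj" by (rule ext) (simp add: eq[unfolded i] complex_eq_iff)
    then show ?thesis ..
  qed
qed

text \<open>The semilinear extension of \<open>S\<close> by \<open>e \<mapsto> e'\<close>.\<close>

definition T :: "'a \<Rightarrow> 'a" where "T v = \<sigma> (cinner v e) *\<^sub>C e' + S (v - cinner v e *\<^sub>C e)"

lemma part_perp [simp]: "cinner (v - cinner v e *\<^sub>C e) e = 0"
  by (simp add: cinner_diff_left e)

lemma T_add: "T (v + w) = T v + T w"
proof -
  have "v + w - cinner (v + w) e *\<^sub>C e = (v - cinner v e *\<^sub>C e) + (w - cinner w e *\<^sub>C e)"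
    by (simp add: cinner_add_left scaleC_add_left)
  then have "S (v + w - cinner (v + w) e *\<^sub>C e) = S (v - cinner v e *\<^sub>C e) + S (w - cinner w e *\<^sub>C e)"
    by (simp only: S_add part_perp)
  then show ?thesis by (simp add: T_def cinner_add_left sigma_add scaleC_add_left)
qed

lemma T_scale: "T (c *\<^sub>C v) = \<sigma> c *\<^sub>C T v"
proof -
  have "c *\<^sub>C v - cinner (c *\<^sub>C v) e *\<^sub>C e = c *\<^sub>C (v - cinner v e *\<^sub>C e)"
    by (simp add: complex_vector.scale_right_diff_distrib)
  then show ?thesis using S_scale[of "v - cinner v e *\<^sub>C e" c]
    by (simp add: T_def sigma_mult scaleC_add_right)
qed

lemma T_cinner: "cinner (T v) (T w) = \<sigma> (cinner v w)"
proof -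
  have ew: "cinner e (w - cinner w e *\<^sub>C e) = 0" for w
    by (rule cinner_eq_0_sym[OF part_perp])
  have "cinner (T v) (T w) = \<sigma> (cinner v e) * cnj (\<sigma> (cinner w e)) +
      cinner (S (v - cinner v e *\<^sub>C e)) (S (w - cinner w e *\<^sub>C e))"
    by (simp add: T_def cinner_add_left cinner_add_right e'_unit)
  also have "\<dots> = \<sigma> (cinner v e * cnj (cinner w e) + cinner (v - cinner v e *\<^sub>C e) (w - cinner w e *\<^sub>C e))"
    by (simp add: S_cinner sigma_add sigma_mult sigma_cnj)
  also have "cinner v e * cnj (cinner w e) + cinner (v - cinner v e *\<^sub>C e) (w - cinner w e *\<^sub>C e) = cinner v w"
    by (simp add: cinner_diff_left cinner_diff_right e cinner_commute[of e w])
  finally show ?thesis .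
qed

lemma phi_T: "\<exists>c. \<phi> v = c *\<^sub>C T v"
proof (cases "cinner v e = 0")
  case True
  then show ?thesis using phi_S[OF True] by (simp add: T_def sigma_zero)
next
  case False
  define a where "a = cinner v e"
  define x where "x = (1 / a) *\<^sub>C (v - a *\<^sub>C e)"
  have a0: "a \<noteq> 0" using False by (simp add: a_def)
  have x: "cinner x e = 0" by (simp add: x_def a_def)
  have v: "v = a *\<^sub>C (e + x)" using a0 by (simp add: x_def scaleC_add_right)
  obtain c where c: "\<phi> v = c *\<^sub>C \<phi> (e + x)"
  proof -
    assume that: "\<And>c. \<phi> v = c *\<^sub>C \<phi> (e + x) \<Longrightarrow> thesis"
    have "v = a *\<^sub>C (e + x) + 0 *\<^sub>C (e + x)" using v by simp
    then obtain c d where "\<phi> v = c *\<^sub>C \<phi> (e + x) + d *\<^sub>C \<phi> (e + x)" using phi_span by blast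
    then show thesis using that[of "c + d"] by (simp add: scaleC_add_left)
  qed
  obtain k where k: "\<phi> (e + x) = k *\<^sub>C (e' + S x)" using phi_affine(1)[OF x] by blast
  have "T (e + x) = e' + S x" using x by (simp add: T_def cinner_add_left e sigma_one)
  then have Tv: "T v = \<sigma> a *\<^sub>C (e' + S x)" by (simp add: v T_scale)
  have "\<sigma> a \<noteq> 0" using sigma_cases a0 by auto
  then have "\<phi> v = (c * k / \<sigma> a) *\<^sub>C T v" unfolding c k Tv by simp
  then show ?thesis by blast
qed

lemma T_surj: "\<exists>v. T v = y"
proof -
  obtain x c where "y = c *\<^sub>C \<phi> x" using onto by blast
  moreover obtain d where "\<phi> x = d *\<^sub>C T x" using phi_T by blast
  moreover have "\<sigma> (\<sigma> (c * d)) = c * d" using sigma_cases by auto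
  ultimately have "T (\<sigma> (c * d) *\<^sub>C x) = y" by (simp add: T_scale)
  then show ?thesis by blast
qed

end

text \<open>Uhlhorn's theorem: since there are vectors orthogonal to two given ones, unit vectors \<open>e\<close> and \<open>u\<close>
  as above exist, and the map constructed from them is an isometry, linear or antilinear according
  to \<open>s\<close>.\<close>

theorem orthogonality_preserving_rays:
  fixes \<phi> :: "'a::complex_hilbert \<Rightarrow> 'a"
  assumes dim3: "\<And>a b :: 'a. \<exists>c. c \<noteq> 0 \<and> cinner c a = 0 \<and> cinner c b = 0"
    and orth: "\<And>x y. cinner (\<phi> x) (\<phi> y) = 0 \<longleftrightarrow> cinner x y = 0"
    and onto: "\<And>y. \<exists>x c. y = c *\<^sub>C \<phi> x"
  obtains T s where "s = id \<or> s = cnj" "\<And>x y. T (x + y) = T x + T y"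
    "\<And>c x. T (c *\<^sub>C x) = s c *\<^sub>C T x" "\<And>x y. cinner (T x) (T y) = s (cinner x y)"
    "\<And>y. \<exists>x. T x = y" "\<And>x. \<exists>c. \<phi> x = c *\<^sub>C T x"
proof -
  have unit: "cinner (a /\<^sub>R norm a) (a /\<^sub>R norm a) = 1" if "a \<noteq> 0" for a :: 'a
    using unit_multiple(1)[OF that] by (simp add: cinner_self del: cinner_scaleR_left cinner_scaleR_right)
  obtain a :: 'a where a: "a \<noteq> 0" using dim3[of 0 0] by auto
  define e where "e = a /\<^sub>R norm a"
  obtain b where b: "b \<noteq> 0" "cinner b e = 0" using dim3[of e e] by auto
  define u where "u = b /\<^sub>R norm b"
  interpret ray_orthogonality \<phi> e u
  proof
    show "cinner e e = 1" unfolding e_def by (rule unit[OF a])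
    show "cinner u u = 1" unfolding u_def by (rule unit[OF b(1)])
    show "cinner u e = 0" using b by (simp add: u_def)
    show "cinner (\<phi> x) (\<phi> y) = 0 \<longleftrightarrow> cinner x y = 0" for x y by (rule orth)
    show "\<exists>x c. y = c *\<^sub>C \<phi> x" for y by (rule onto)
    show "\<exists>c :: 'a. c \<noteq> 0 \<and> cinner c a = 0 \<and> cinner c b = 0" for a b by (rule dim3)
  qed
  show ?thesis
    by (rule that[OF sigma_cases T_add T_scale T_cinner T_surj phi_T])
qed

section \<open>Rank one operators\<close>

lemma outer_prod_bounded_ops: "outer_prod x f \<in> bounded_ops"
proof (rule bounded_opsI[of _ "norm f * norm x"])
  show "norm (outer_prod x f z) \<le> norm f * norm x * norm z" for z
    using mult_right_mono[OF norm_cinner_le[of z f], of "norm x"] by (simp add: outer_prod_def ac_simps)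
qed (simp_all add: outer_prod_def cinner_add_left scaleC_add_left)

lemma cadj_outer_prod: "cadj (outer_prod x f) = outer_prod f x"
  by (rule cadj_eqI) (simp add: outer_prod_def cinner_commute[of x] mult.commute)

lemma cadj_outer_comp:
  "B \<in> bounded_ops \<Longrightarrow> cadj (outer_prod x f) \<circ> B = outer_prod f (cadj B x)"
  unfolding cadj_outer_prod by (rule ext) (simp add: outer_prod_def cadj_cinner)

lemma outer_prod_zero [simp]: "outer_prod 0 f = (\<lambda>_. 0)" "outer_prod x 0 = (\<lambda>_. 0)"
  by (simp_all add: outer_prod_def)

lemma outer_prod_eq_0: "outer_prod x f = (\<lambda>_. 0) \<longleftrightarrow> x = 0 \<or> f = 0"
proof
  assume "outer_prod x f = (\<lambda>_. 0)"
  then have "outer_prod x f f = 0" by (rule fun_cong)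
  then show "x = 0 \<or> f = 0" by (simp add: outer_prod_def disj_commute)
qed auto

lemma outer_prod_scaleC: "outer_prod (c *\<^sub>C x) f = outer_prod x (cnj c *\<^sub>C f)"
  by (simp add: outer_prod_def mult.commute)

lemma outer_prod_scaleR_left: "outer_prod (r *\<^sub>R x) f = (\<lambda>z. r *\<^sub>R outer_prod x f z)"
  by (rule ext) (simp add: outer_prod_def scaleC_of_real[symmetric] mult.commute)

lemma outer_prod_scaleR_right: "outer_prod x (r *\<^sub>R f) = outer_prod (r *\<^sub>R x) f"
  by (rule ext) (simp add: outer_prod_def scaleC_of_real[symmetric] mult.commute)

text \<open>If \<open>x\<close> spans the range of \<open>A\<close>, then the coefficient of \<open>A z\<close> at \<open>x\<close> is an inner product of \<open>z\<close> with the
  value of the adjoint of \<open>A\<close> at a multiple of \<open>x\<close>.\<close>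

lemma rank_one_iff_outer_prod:
  "A \<in> rank_one_ops \<longleftrightarrow> (\<exists>x f. x \<noteq> 0 \<and> f \<noteq> 0 \<and> A = outer_prod x f)"
proof
  assume "A \<in> rank_one_ops"
  then have A: "A \<in> bounded_ops" "complex_vector.dim (range A) = 1" by (auto simp: rank_one_ops_def)
  obtain B where B: "B \<subseteq> range A" "complex_vector.independent B" "range A \<subseteq> complex_vector.span B" "card B = 1"
    using complex_vector.basis_exists[of "range A"] A(2) by metis
  obtain x where x: "B = {x}" using B(4) card_1_singletonE by blast
  have x0: "x \<noteq> 0" using B(2) complex_vector.dependent_zero x by auto
  define f where "f = cadj A (complex_of_real (1 / (norm x)\<^sup>2) *\<^sub>C x)"
  have "A z = outer_prod x f z" for z
  proof -
    have "A z \<in> range (\<lambda>k. k *\<^sub>C x)" using B(3) x complex_vector.span_singleton by blast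
    then obtain k where k: "A z = k *\<^sub>C x" by blast
    have "cinner z f = k"
      unfolding f_def cadj_cinner[OF A(1), symmetric] k using x0 by (simp add: cinner_self)
    then show ?thesis using k by (simp add: outer_prod_def)
  qed
  then have eq: "A = outer_prod x f" by auto
  moreover have "f \<noteq> 0"
  proof
    assume "f = 0"
    then have "range A = {0}" using eq by auto
    then show False using B(1) x x0 by auto
  qed
  ultimately show "\<exists>x f. x \<noteq> 0 \<and> f \<noteq> 0 \<and> A = outer_prod x f" using x0 by blast
next
  assume "\<exists>x f. x \<noteq> 0 \<and> f \<noteq> 0 \<and> A = outer_prod x f"
  then obtain x f where xf: "x \<noteq> 0" "f \<noteq> 0" "A = outer_prod x f" by blast
  have "k *\<^sub>C x = A ((k / cinner f f) *\<^sub>C f)" for k using xf by (simp add: outer_prod_def)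
  then have "range (\<lambda>k. k *\<^sub>C x) \<subseteq> range A" by (metis image_subsetI rangeI)
  then have "complex_vector.span {x} = range A"
    unfolding complex_vector.span_singleton xf(3) by (auto simp: outer_prod_def)
  moreover have "complex_vector.dim (complex_vector.span {x}) = 1"
    using xf(1) complex_vector.dim_span_eq_card_independent[of "{x}"] by simp
  ultimately show "A \<in> rank_one_ops" using xf by (simp add: rank_one_ops_def outer_prod_bounded_ops)
qed

lemma outer_prod_rank_one: "x \<noteq> 0 \<Longrightarrow> f \<noteq> 0 \<Longrightarrow> outer_prod x f \<in> rank_one_ops"
  using rank_one_iff_outer_prod by blast

definition ranges_orthogonal :: "('a::complex_hilbert \<Rightarrow> 'a) \<Rightarrow> ('a \<Rightarrow> 'a) \<Rightarrow> bool" where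
  "ranges_orthogonal A B \<longleftrightarrow> (\<forall>x y. cinner (A x) (B y) = 0)"

lemma ranges_orthogonal_iff:
  assumes "A \<in> bounded_ops"
  shows "cadj A \<circ> B = (\<lambda>_. 0) \<longleftrightarrow> ranges_orthogonal A B"
proof
  assume "cadj A \<circ> B = (\<lambda>_. 0)"
  then have "cadj A (B y) = 0" for y by (metis comp_apply)
  then show "ranges_orthogonal A B" by (simp add: ranges_orthogonal_def cadj_cinner[OF assms])
next
  assume "ranges_orthogonal A B"
  then have "cinner x (cadj A (B y)) = cinner x 0" for x y
    by (simp add: ranges_orthogonal_def cadj_cinner[OF assms, symmetric])
  then have "cadj A (B y) = 0" for y by (rule cinner_eqI_right)
  then show "cadj A \<circ> B = (\<lambda>_. 0)" by auto
qed

lemma ranges_orthogonal_self: "ranges_orthogonal A A \<longleftrightarrow> A = (\<lambda>_. 0)"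
proof
  assume "ranges_orthogonal A A"
  then have "cinner (A x) (A x) = 0" for x unfolding ranges_orthogonal_def by blast
  then show "A = (\<lambda>_. 0)" by (intro ext) simp
qed (simp add: ranges_orthogonal_def)

lemma ranges_orthogonal_outer_left:
  assumes "f \<noteq> 0"
  shows "ranges_orthogonal (outer_prod x f) B \<longleftrightarrow> (\<forall>y. cinner x (B y) = 0)"
proof -
  have "\<exists>z. cinner z f \<noteq> 0" using assms by (intro exI[of _ f]) simp
  then show ?thesis by (auto simp: ranges_orthogonal_def outer_prod_def)
qed

lemma ranges_orthogonal_outer_right:
  assumes "f \<noteq> 0"
  shows "ranges_orthogonal A (outer_prod y f) \<longleftrightarrow> (\<forall>x. cinner (A x) y = 0)"
proof -
  have "\<exists>z. cinner z f \<noteq> 0" using assms by (intro exI[of _ f]) simp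
  then show ?thesis by (auto simp: ranges_orthogonal_def outer_prod_def)
qed

lemma ranges_orthogonal_outer_outer:
  assumes "b \<noteq> 0" "d \<noteq> 0"
  shows "ranges_orthogonal (outer_prod a b) (outer_prod c d) \<longleftrightarrow> cinner a c = 0"
proof -
  have "\<exists>y. cinner y d \<noteq> 0" using assms by (intro exI[of _ d]) simp
  then show ?thesis
    unfolding ranges_orthogonal_outer_left[OF assms(1)] by (auto simp: outer_prod_def)
qed

lemma double_perp_one:
  assumes "\<And>z. cinner x z = 0 \<Longrightarrow> cinner v z = 0"
  shows "\<exists>k. v = k *\<^sub>C x"
proof -
  obtain a b where "v = a *\<^sub>C x + b *\<^sub>C x" using double_perp_two[of x x v] assms by blast
  then have "v = (a + b) *\<^sub>C x" by (simp add: scaleC_add_left)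
  then show ?thesis by blast
qed

text \<open>Rank one is a property of the orthogonality relation alone: it says that the closed range is
  minimal nonzero, that is, that the set of operators orthogonal to \<open>A\<close> is maximal. The rank one
  operators \<open>y \<otimes> y\<close> in \<open>AA\<close> suffice to compare ranges, because they detect orthogonality to each vector
  \<open>y\<close>.\<close>

lemma rank_one_iff_minimal:
  assumes AA: "rank_one_ops \<subseteq> AA" "AA \<subseteq> bounded_ops" and A: "A \<in> AA"
  shows "A \<in> rank_one_ops \<longleftrightarrow> \<not> ranges_orthogonal A A \<and>
    (\<forall>C\<in>AA. \<not> ranges_orthogonal C C \<and> (\<forall>B\<in>AA. ranges_orthogonal A B \<longrightarrow> ranges_orthogonal C B)
        \<longrightarrow> (\<forall>B\<in>AA. ranges_orthogonal C B \<longrightarrow> ranges_orthogonal A B))"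
    (is "_ \<longleftrightarrow> ?min")
proof
  assume "A \<in> rank_one_ops"
  then obtain x f where xf: "x \<noteq> 0" "f \<noteq> 0" "A = outer_prod x f" using rank_one_iff_outer_prod by blast
  have "\<not> ranges_orthogonal A A"
    using xf by (simp add: ranges_orthogonal_self outer_prod_eq_0)
  moreover have "ranges_orthogonal A B"
    if C: "C \<in> AA" "\<not> ranges_orthogonal C C"
      and le: "\<forall>B\<in>AA. ranges_orthogonal A B \<longrightarrow> ranges_orthogonal C B"
      and B: "B \<in> AA" "ranges_orthogonal C B" for C B
  proof -
    have "\<exists>k. C z = k *\<^sub>C x" for z
    proof (rule double_perp_one)
      fix y assume y: "cinner x y = 0"
      show "cinner (C z) y = 0"
      proof (cases "y = 0")
        case False
        have "ranges_orthogonal A (outer_prod y y)"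
          using False y xf(2) by (simp add: ranges_orthogonal_outer_outer xf(3))
        moreover have "outer_prod y y \<in> AA" using outer_prod_rank_one False AA by blast
        ultimately have "ranges_orthogonal C (outer_prod y y)" using le by blast
        then show ?thesis using False by (simp add: ranges_orthogonal_outer_right)
      qed simp
    qed
    moreover obtain z where "C z \<noteq> 0" using C(2) by (auto simp: ranges_orthogonal_self)
    ultimately obtain k where k: "C z = k *\<^sub>C x" "k \<noteq> 0" by (metis complex_vector.scale_zero_left)
    have "cinner x (B y) = 0" for y
      using B(2) k by (metis cinner_scaleC_left mult_eq_0_iff ranges_orthogonal_def)
    then show ?thesis using xf by (simp add: ranges_orthogonal_outer_left)
  qed
  ultimately show ?min by blast
next
  assume min: ?min
  then have "A \<noteq> (\<lambda>_. 0)" by (simp add: ranges_orthogonal_self)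
  then obtain z where z: "A z \<noteq> 0" by (auto simp: fun_eq_iff)
  define x where "x = A z"
  have C: "outer_prod x x \<in> AA" using outer_prod_rank_one AA z x_def by blast
  have "\<not> ranges_orthogonal (outer_prod x x) (outer_prod x x)"
    using z by (simp add: x_def ranges_orthogonal_self outer_prod_eq_0)
  moreover have "\<forall>B\<in>AA. ranges_orthogonal A B \<longrightarrow> ranges_orthogonal (outer_prod x x) B"
    using z by (simp add: ranges_orthogonal_outer_left x_def) (simp add: ranges_orthogonal_def)
  ultimately have le: "\<forall>B\<in>AA. ranges_orthogonal (outer_prod x x) B \<longrightarrow> ranges_orthogonal A B"
    using min C by blast
  have "\<exists>k. A w = k *\<^sub>C x" for w
  proof (rule double_perp_one)
    fix y assume y: "cinner x y = 0"
    show "cinner (A w) y = 0"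
    proof (cases "y = 0")
      case False
      have "ranges_orthogonal (outer_prod x x) (outer_prod y y)"
        using False y z by (simp add: ranges_orthogonal_outer_outer x_def)
      moreover have "outer_prod y y \<in> AA" using outer_prod_rank_one False AA by blast
      ultimately have "ranges_orthogonal A (outer_prod y y)" using le by blast
      then show ?thesis using False by (simp add: ranges_orthogonal_outer_right)
    qed simp
  qed
  then have sub: "range A \<subseteq> complex_vector.span {x}" by (auto simp: complex_vector.span_singleton)
  have "k *\<^sub>C x = A (k *\<^sub>C z)" for k using A AA by (simp add: subset_iff bounded_opsD x_def)
  then have "complex_vector.span {x} \<subseteq> range A"
    unfolding complex_vector.span_singleton by (metis image_subsetI rangeI)
  then have "range A = complex_vector.span {x}" using sub by blast
  moreover have "complex_vector.dim (complex_vector.span {x}) = 1"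
    using z x_def complex_vector.dim_span_eq_card_independent[of "{x}"] by simp
  ultimately show "A \<in> rank_one_ops" using A AA by (auto simp: rank_one_ops_def)
qed

locale orthogonality_map =
  fixes AA BB :: "('a::complex_hilbert \<Rightarrow> 'a) set" and \<Phi> :: "('a \<Rightarrow> 'a) \<Rightarrow> 'a \<Rightarrow> 'a"
  assumes dim3: "\<exists>c :: 'a. c \<noteq> 0 \<and> cinner c a = 0 \<and> cinner c b = 0"
    and AA: "rank_one_ops \<subseteq> AA" "AA \<subseteq> bounded_ops"
    and BB: "rank_one_ops \<subseteq> BB" "BB \<subseteq> bounded_ops"
    and surj: "\<Phi> ` AA = BB"
    and orth: "A \<in> AA \<Longrightarrow> B \<in> AA \<Longrightarrow>
      cadj A \<circ> B = (\<lambda>_. 0) \<longleftrightarrow> cadj (\<Phi> A) \<circ> \<Phi> B = (\<lambda>_. 0)"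
begin

lemma Phi_bounded: "A \<in> AA \<Longrightarrow> \<Phi> A \<in> bounded_ops"
  using surj BB by blast

lemma ranges_orthogonal_Phi:
  assumes "A \<in> AA" "B \<in> AA"
  shows "ranges_orthogonal (\<Phi> A) (\<Phi> B) \<longleftrightarrow> ranges_orthogonal A B"
proof -
  have "A \<in> bounded_ops" using assms AA by blast
  then show ?thesis
    using orth[OF assms] ranges_orthogonal_iff Phi_bounded[OF assms(1)] by blast
qed

lemma rank_one_Phi:
  assumes A: "A \<in> AA" shows "A \<in> rank_one_ops \<longleftrightarrow> \<Phi> A \<in> rank_one_ops"
proof -
  have "\<Phi> A \<in> BB" using A surj by blast
  have ball: "(\<forall>C\<in>BB. P C) \<longleftrightarrow> (\<forall>C\<in>AA. P (\<Phi> C))" for P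
    using surj by blast
  show ?thesis
    unfolding rank_one_iff_minimal[OF AA A] rank_one_iff_minimal[OF BB \<open>\<Phi> A \<in> BB\<close>] ball
    by (simp only: ranges_orthogonal_Phi A cong: ball_cong)
qed

text \<open>A vector of the ray to which \<open>\<Phi>\<close> sends the ray of \<open>x\<close>.\<close>

definition \<phi> :: "'a \<Rightarrow> 'a" where
  "\<phi> x = (if x = 0 then 0 else SOME y. y \<noteq> 0 \<and> (\<exists>g. g \<noteq> 0 \<and> \<Phi> (outer_prod x x) = outer_prod y g))"

lemma outer_in_AA: "x \<noteq> 0 \<Longrightarrow> f \<noteq> 0 \<Longrightarrow> outer_prod x f \<in> AA"
  using outer_prod_rank_one AA by blast

lemma outer_in_BB: "x \<noteq> 0 \<Longrightarrow> f \<noteq> 0 \<Longrightarrow> outer_prod x f \<in> BB"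
  using outer_prod_rank_one BB by blast

lemma Phi_reaches_outer: "x \<noteq> 0 \<Longrightarrow> f \<noteq> 0 \<Longrightarrow> \<exists>A\<in>AA. \<Phi> A = outer_prod x f"
  using outer_in_BB unfolding surj[symmetric] by (metis imageE)

lemma Phi_outer:
  assumes "x \<noteq> 0" "f \<noteq> 0"
  shows "\<exists>y g. y \<noteq> 0 \<and> g \<noteq> 0 \<and> \<Phi> (outer_prod x f) = outer_prod y g"
proof -
  have "\<Phi> (outer_prod x f) \<in> rank_one_ops"
    using rank_one_Phi[OF outer_in_AA[OF assms]] outer_prod_rank_one[OF assms] by blast
  then show ?thesis unfolding rank_one_iff_outer_prod by blast
qed

lemma phi_spec:
  assumes "x \<noteq> 0"
  shows "\<phi> x \<noteq> 0" "\<exists>g. g \<noteq> 0 \<and> \<Phi> (outer_prod x x) = outer_prod (\<phi> x) g"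
proof -
  have ex: "\<exists>y. y \<noteq> 0 \<and> (\<exists>g. g \<noteq> 0 \<and> \<Phi> (outer_prod x x) = outer_prod y g)"
    using Phi_outer[OF assms assms] by blast
  have eq: "\<phi> x = (SOME y. y \<noteq> 0 \<and> (\<exists>g. g \<noteq> 0 \<and> \<Phi> (outer_prod x x) = outer_prod y g))"
    using assms by (simp only: \<phi>_def if_False)
  have "\<phi> x \<noteq> 0 \<and> (\<exists>g. g \<noteq> 0 \<and> \<Phi> (outer_prod x x) = outer_prod (\<phi> x) g)"
    unfolding eq by (rule someI_ex[OF ex])
  then show "\<phi> x \<noteq> 0" "\<exists>g. g \<noteq> 0 \<and> \<Phi> (outer_prod x x) = outer_prod (\<phi> x) g" by blast+
qed

lemma phi_orth: "cinner (\<phi> x) (\<phi> y) = 0 \<longleftrightarrow> cinner x y = 0"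
proof (cases "x = 0 \<or> y = 0")
  case True
  have "\<phi> 0 = 0" by (simp add: \<phi>_def)
  then show ?thesis using True by auto
next
  case False
  obtain g where g: "g \<noteq> 0" "\<Phi> (outer_prod x x) = outer_prod (\<phi> x) g"
    using phi_spec(2)[of x] False by blast
  obtain h where h: "h \<noteq> 0" "\<Phi> (outer_prod y y) = outer_prod (\<phi> y) h"
    using phi_spec(2)[of y] False by blast
  show ?thesis
    using ranges_orthogonal_Phi[OF outer_in_AA outer_in_AA, of x x y y] False g h
    by (simp add: ranges_orthogonal_outer_outer)
qed

text \<open>The operators \<open>x \<otimes> f\<close> and \<open>x \<otimes> x\<close> are orthogonal to the same operators, so their images have the
  same range.\<close>

lemma Phi_outer_phi:
  assumes x: "x \<noteq> 0" and f: "f \<noteq> 0"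
  shows "\<exists>h. \<Phi> (outer_prod x f) = outer_prod (\<phi> x) h"
proof -
  obtain y g where yg: "y \<noteq> 0" "g \<noteq> 0" "\<Phi> (outer_prod x f) = outer_prod y g"
    using Phi_outer[OF x f] by blast
  obtain g' where g': "g' \<noteq> 0" "\<Phi> (outer_prod x x) = outer_prod (\<phi> x) g'" using phi_spec[OF x] by blast
  have "\<exists>k. y = k *\<^sub>C \<phi> x"
  proof (rule double_perp_one)
    fix z assume z: "cinner (\<phi> x) z = 0"
    show "cinner y z = 0"
    proof (cases "z = 0")
      case False
      obtain B where B: "B \<in> AA" "\<Phi> B = outer_prod z z" using Phi_reaches_outer[OF False False] by blast
      have "ranges_orthogonal (\<Phi> (outer_prod x x)) (\<Phi> B)"
        unfolding B(2) g'(2) using False z g'(1) by (simp add: ranges_orthogonal_outer_outer)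
      then have "ranges_orthogonal (outer_prod x x) B"
        using ranges_orthogonal_Phi[OF outer_in_AA[OF x x] B(1)] by blast
      then have "ranges_orthogonal (outer_prod x f) B"
        using x f by (simp add: ranges_orthogonal_outer_left)
      then have "ranges_orthogonal (outer_prod y g) (outer_prod z z)"
        using ranges_orthogonal_Phi[OF outer_in_AA[OF x f] B(1)] by (simp add: B(2) yg(3))
      then show ?thesis using False yg(2) by (simp add: ranges_orthogonal_outer_outer)
    qed simp
  qed
  then obtain k where "y = k *\<^sub>C \<phi> x" by blast
  then have "\<Phi> (outer_prod x f) = outer_prod (\<phi> x) (cnj k *\<^sub>C g)"
    using yg(3) by (simp only: outer_prod_scaleC)
  then show ?thesis by blast
qed

lemma phi_onto: "\<exists>x c. y = c *\<^sub>C \<phi> x"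
proof (cases "y = 0")
  case False
  obtain A where A: "A \<in> AA" "\<Phi> A = outer_prod y y" using Phi_reaches_outer[OF False False] by blast
  then have "A \<in> rank_one_ops" using rank_one_Phi outer_prod_rank_one[OF False False] by simp
  then obtain x f where xf: "x \<noteq> 0" "f \<noteq> 0" "A = outer_prod x f" using rank_one_iff_outer_prod by blast
  then obtain h where "outer_prod y y = outer_prod (\<phi> x) h"
    using Phi_outer_phi[OF xf(1,2)] A(2) by auto
  then have "outer_prod y y y = outer_prod (\<phi> x) h y" by simp
  then have "cinner y y *\<^sub>C y = cinner y h *\<^sub>C \<phi> x" by (simp add: outer_prod_def)
  then have "(1 / cinner y y) *\<^sub>C cinner y y *\<^sub>C y = (1 / cinner y y) *\<^sub>C cinner y h *\<^sub>C \<phi> x" by simp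
  then have "y = (cinner y h / cinner y y) *\<^sub>C \<phi> x" using False by simp
  then show ?thesis by blast
qed (auto intro: exI[of _ 0])

lemma Phi_zero: "(\<lambda>_. 0) \<in> AA \<Longrightarrow> \<Phi> (\<lambda>_. 0) = (\<lambda>_. 0)"
  using ranges_orthogonal_Phi[of "\<lambda>_. 0" "\<lambda>_. 0"] by (simp add: ranges_orthogonal_self)

text \<open>The second factor is undetermined where the operator is zero; there \<open>h x f\<close> is set to \<open>f\<close>, which is
  consistent because \<open>\<Phi>\<close> sends the zero operator, if it is in the domain, to itself.\<close>

lemma rank_one_action:
  obtains T s h where "s = id \<or> s = cnj" "\<And>x y. T (x + y) = T x + T y"
    "\<And>c x. T (c *\<^sub>C x) = s c *\<^sub>C T x" "\<And>x. norm (T x) = norm x" "\<And>y. \<exists>x. T x = y"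
    "\<And>x f. outer_prod x f \<in> AA \<Longrightarrow> \<Phi> (outer_prod x f) = outer_prod (T x) (h x f)"
    "\<And>x f. x = 0 \<or> f = 0 \<Longrightarrow> h x f = f"
proof -
  obtain T s where s: "s = id \<or> s = cnj" and T: "\<And>x y. T (x + y) = T x + T y"
    "\<And>c x. T (c *\<^sub>C x) = s c *\<^sub>C T x" "\<And>x y. cinner (T x) (T y) = s (cinner x y)"
    "\<And>y. \<exists>x. T x = y" "\<And>x. \<exists>c. \<phi> x = c *\<^sub>C T x"
    by (rule orthogonality_preserving_rays[OF dim3 phi_orth phi_onto]) blast
  have norm: "norm (T x) = norm x" for x
  proof -
    have "cinner (T x) (T x) = s (cinner x x)" by (rule T(3))
    also have "\<dots> = cinner x x" using s by (auto simp: cinner_self)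
    finally show ?thesis unfolding norm_eq_iff_cinner .
  qed
  then have T0: "T 0 = 0" by (metis norm_eq_zero)
  have "\<exists>h. \<Phi> (outer_prod x f) = outer_prod (T x) h" if xf: "x \<noteq> 0" "f \<noteq> 0" for x f
  proof -
    obtain g c where "\<Phi> (outer_prod x f) = outer_prod (\<phi> x) g" "\<phi> x = c *\<^sub>C T x"
      using Phi_outer_phi[OF xf] T(5) by blast
    then have "\<Phi> (outer_prod x f) = outer_prod (T x) (cnj c *\<^sub>C g)" by (simp only: outer_prod_scaleC)
    then show ?thesis by blast
  qed
  then obtain h0 where h0: "\<And>x f. x \<noteq> 0 \<Longrightarrow> f \<noteq> 0 \<Longrightarrow> \<Phi> (outer_prod x f) = outer_prod (T x) (h0 x f)"
    by metis
  define h where "h x f = (if x = 0 \<or> f = 0 then f else h0 x f)" for x f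
  have Phi: "\<Phi> (outer_prod x f) = outer_prod (T x) (h x f)" if "outer_prod x f \<in> AA" for x f
  proof (cases "x = 0 \<or> f = 0")
    case True
    then have "outer_prod x f = (\<lambda>_. 0)" by auto
    moreover have "outer_prod (T x) (h x f) = (\<lambda>_. 0)" using True T0 by (auto simp: h_def)
    ultimately show ?thesis using Phi_zero that by simp
  qed (simp add: h_def h0)
  show ?thesis
    by (rule that[OF s T(1,2) norm T(4) Phi]) (auto simp: h_def)
qed

end

section \<open>Unitarily invariant functions of rank one operators\<close>

text \<open>Multiply \<open>w\<close> by a phase \<open>\<mu>\<close> that makes \<open>cinner v (\<mu> *\<^sub>C w)\<close> real. Then the Householder reflection \<open>R\<close> along
  \<open>v - \<mu> *\<^sub>C w\<close> takes \<open>v\<close> to \<open>\<mu> *\<^sub>C w\<close>, and it remains to remove the phase.\<close>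

lemma unit_vector_transitive:
  fixes v w :: "'a::complex_hilbert"
  assumes "norm v = 1" "norm w = 1"
  shows "\<exists>U. unitary_op U \<and> U v = w"
proof -
  define c where "c = cinner v w"
  define \<mu> where "\<mu> = (if c = 0 then 1 else c / complex_of_real (cmod c))"
  have mu: "cmod \<mu> = 1" by (simp add: \<mu>_def norm_divide)
  then have mu2: "cnj \<mu> * \<mu> = 1" by (metis complex_norm_square mult.commute of_real_1 power_one)
  have real: "cnj \<mu> * c = complex_of_real (cmod c)"
  proof (cases "c = 0")
    case False
    then have "cnj \<mu> * c = (c * cnj c) / complex_of_real (cmod c)" by (simp add: \<mu>_def)
    also have "\<dots> = complex_of_real (cmod c)"
      using False by (simp add: complex_norm_square[symmetric] power2_eq_square)
    finally show ?thesis .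
  qed simp
  define d where "d = v - \<mu> *\<^sub>C w"
  define R where "R z = z - (2 * cinner z d / cinner d d) *\<^sub>C d" for z
  define U where "U z = cnj \<mu> *\<^sub>C R z" for z
  have vv: "cinner v v = 1" "cinner w w = 1" using assms by (simp_all add: cinner_self)
  have vd: "cinner v d = 1 - complex_of_real (cmod c)"
    using real by (simp add: d_def cinner_diff_right vv c_def)
  have wv: "\<mu> * cinner w v = complex_of_real (cmod c)"
  proof -
    have "\<mu> * cinner w v = cnj (cnj \<mu> * c)" by (simp add: c_def cinner_commute[of w v])
    then show ?thesis by (simp add: real)
  qed
  have dd: "cinner d d = 2 * cinner v d"
  proof -
    have "cinner d d = cinner v d - (\<mu> * cinner w v - \<mu> * cnj \<mu>)"
      by (subst d_def) (simp add: cinner_diff_left, simp add: d_def cinner_diff_right vv right_diff_distrib)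
    then show ?thesis using wv vd mu2 by (simp add: mult.commute)
  qed
  have Rv: "R v = \<mu> *\<^sub>C w"
  proof (cases "d = 0")
    case True
    then show ?thesis by (simp add: R_def d_def)
  next
    case False
    then have "cinner d d \<noteq> 0" by simp
    then have "R v = v - d" by (simp add: R_def dd[symmetric])
    then show ?thesis by (simp add: d_def)
  qed
  have R_add: "R (x + y) = R x + R y" for x y
    by (simp add: R_def cinner_add_left distrib_left add_divide_distrib scaleC_add_left)
  have R_scale: "R (k *\<^sub>C x) = k *\<^sub>C R x" for k x
    by (simp add: R_def complex_vector.scale_right_diff_distrib mult.left_commute)
  have Rd: "cinner (R z) d = - cinner z d" for z
    by (cases "d = 0") (simp_all add: R_def cinner_diff_left)
  have R_R: "R (R z) = z" for z
  proof -
    have "R (R z) = R z - (2 * cinner (R z) d / cinner d d) *\<^sub>C d" by (subst R_def) simp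
    also have "\<dots> = R z + (2 * cinner z d / cinner d d) *\<^sub>C d" by (simp add: Rd)
    finally show ?thesis by (simp add: R_def)
  qed
  have R_norm: "norm (R z) = norm z" for z
  proof -
    let ?k = "2 * cinner z d / cinner d d"
    have dR: "cinner d (R z) = - cinner d z"
      by (metis Rd cinner_commute complex_cnj_minus)
    have "cinner (R z) (R z) = cinner z (R z) - ?k * cinner d (R z)"
      by (subst (1) R_def) (simp add: cinner_diff_left)
    also have "\<dots> = cinner z (R z) + ?k * cinner d z" by (simp add: dR)
    also have "cinner z (R z) = cinner z z - cnj ?k * cinner z d"
      by (simp add: R_def cinner_diff_right)
    also have "cnj ?k * cinner z d = ?k * cinner d z"
      by (simp add: cinner_commute[of d z] cinner_commute[of d d, symmetric])
    finally have "cinner (R z) (R z) = cinner z z" by simp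
    then show ?thesis by (simp add: norm_eq_iff_cinner)
  qed
  have "unitary_op U"
  proof (rule unitary_opI)
    show "U (x + y) = U x + U y" for x y by (simp add: U_def R_add scaleC_add_right)
    show "U (k *\<^sub>C x) = k *\<^sub>C U x" for k x by (simp add: U_def R_scale mult.commute)
    show "norm (U x) = norm x" for x by (simp add: U_def R_norm mu)
    show "\<exists>x. U x = y" for y
      by (intro exI[of _ "\<mu> *\<^sub>C R y"]) (simp add: U_def R_scale R_R mu2)
  qed
  moreover have "U v = w" by (simp add: U_def Rv mu2)
  ultimately show ?thesis by blast
qed

lemma conjugate_outer_prod:
  assumes "unitary_op U"
  shows "(\<lambda>z. U (outer_prod x f (cadj U z))) = outer_prod (U x) (U f)"
  using unitary_opD[OF assms] by (simp add: outer_prod_def bounded_opsD cadj_cinner' cinner_commute[of _ f])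

lemma onorm_outer_prod: "onorm (outer_prod x f) = norm x * norm f"
proof (rule antisym)
  show "onorm (outer_prod x f) \<le> norm x * norm f"
    by (rule onorm_bound) (use mult_right_mono[OF norm_cinner_le[of _ f], of "norm x"]
        in \<open>simp_all add: outer_prod_def ac_simps\<close>)
  show "norm x * norm f \<le> onorm (outer_prod x f)"
  proof (cases "f = 0")
    case True
    then show ?thesis by (simp add: onorm_zero)
  next
    case False
    have "norm (outer_prod x f f) \<le> onorm (outer_prod x f) * norm f"
      by (rule onorm[OF bounded_opsD(1)[OF outer_prod_bounded_ops]])
    moreover have "norm (outer_prod x f f) = (norm x * norm f) * norm f"
      unfolding outer_prod_def norm_scaleC cinner_self norm_of_real by (simp add: power2_eq_square)
    ultimately show ?thesis using False by (simp add: mult_le_cancel_right)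
  qed
qed

locale monotone_invariant =
  fixes F :: "('a::complex_hilbert \<Rightarrow> 'a) \<Rightarrow> real"
  assumes inv: "unitarily_invariant F" and mono: "strictly_increasing_on_rays F"
begin

lemma F_unitary:
  assumes "unitary_op U" "x \<noteq> 0" "f \<noteq> 0"
  shows "F (outer_prod (U x) (U f)) = F (outer_prod x f)"
proof -
  have "F (\<lambda>z. 1 *\<^sub>C U (outer_prod x f (cadj U z))) = F (outer_prod x f)"
    using inv assms outer_prod_rank_one[of x f] norm_one unfolding unitarily_invariant_def by blast
  then show ?thesis by (simp add: conjugate_outer_prod[OF assms(1)])
qed

lemma F_mono:
  assumes "x \<noteq> 0" "f \<noteq> 0" "0 \<le> s" "0 \<le> t"
  shows "F (outer_prod (s *\<^sub>R x) f) < F (outer_prod (t *\<^sub>R x) f) \<longleftrightarrow> s < t"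
proof -
  have "strict_mono_on {0..} (\<lambda>t. F (\<lambda>z. t *\<^sub>R outer_prod x f z))"
    using mono outer_prod_rank_one[OF assms(1,2)] unfolding strictly_increasing_on_rays_def by blast
  from strict_mono_on_less[OF this, of s t] show ?thesis
    using assms by (simp add: outer_prod_scaleR_left)
qed

text \<open>Up to unitary equivalence \<open>h \<otimes> h\<close> and \<open>f \<otimes> f\<close> are multiples of one operator \<open>f1 \<otimes> f1\<close>, by the squares of the
  norms, and \<open>F\<close> is injective on its nonnegative multiples.\<close>

lemma norm_eq_of_F_self:
  assumes n: "n > 0" and f: "f \<noteq> 0"
    and eq: "F (outer_prod (n *\<^sub>R h) h) = F (outer_prod (n *\<^sub>R f) f)"
  shows "norm h = norm f"
proof -
  have normalise: "outer_prod (n *\<^sub>R g) g = outer_prod ((n * (norm g)\<^sup>2) *\<^sub>R g1) g1"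
    if "norm g *\<^sub>R g1 = g" for g g1 :: 'a
    by (subst (1 2) that[symmetric])
      (simp add: outer_prod_scaleR_right power2_eq_square ac_simps)
  define f1 where "f1 = f /\<^sub>R norm f"
  note f1 = unit_multiple[OF f, folded f1_def]
  (* For h = 0 any unit vector will do as direction of h. *)
  obtain h1 where h1: "norm h1 = 1" "norm h *\<^sub>R h1 = h"
  proof (cases "h = 0")
    case True
    then show ?thesis using that[of f1] f1 by simp
  next
    case False
    show ?thesis by (rule that[OF unit_multiple[OF False]])
  qed
  obtain U where U: "unitary_op U" "U h1 = f1" using unit_vector_transitive[OF h1(1) f1(1)] by blast
  have nz: "h1 \<noteq> 0" "f1 \<noteq> 0" using h1 f1 by auto
  have transport: "F (outer_prod (t *\<^sub>R h1) h1) = F (outer_prod (t *\<^sub>R f1) f1)" for t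
  proof (cases "t = 0")
    case False
    have "U (t *\<^sub>R h1) = t *\<^sub>R f1" using U unitary_opD(1) bounded_opsD(6) by metis
    then show ?thesis using F_unitary[OF U(1), of "t *\<^sub>R h1" h1] False nz U(2) by simp
  qed simp
  have "F (outer_prod ((n * (norm h)\<^sup>2) *\<^sub>R f1) f1) = F (outer_prod ((n * (norm f)\<^sup>2) *\<^sub>R f1) f1)"
    using eq unfolding normalise[OF h1(2)] normalise[OF f1(2)] transport .
  then have "n * (norm h)\<^sup>2 = n * (norm f)\<^sup>2"
    using F_mono[OF nz(2) nz(2), of "n * (norm h)\<^sup>2" "n * (norm f)\<^sup>2"]
      F_mono[OF nz(2) nz(2), of "n * (norm f)\<^sup>2" "n * (norm h)\<^sup>2"] n by auto
  then show ?thesis using n by (simp add: power2_eq_iff_nonneg)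
qed

lemma extremal_pairs:
  assumes "attains_extrema F"
  obtains u v p q where "norm u = 1" "norm v = 1" "norm p = 1" "norm q = 1"
    "\<And>x f. norm x * norm f = 1 \<Longrightarrow> F (outer_prod x f) \<le> F (outer_prod u v)"
    "\<And>x f. norm x * norm f = 1 \<Longrightarrow> F (outer_prod p q) \<le> F (outer_prod x f)"
proof -
  have unit: "\<exists>u v. norm u = 1 \<and> norm v = 1 \<and> X = outer_prod u v"
    if X: "X \<in> rank_one_ops" "onorm X = 1" for X :: "'a \<Rightarrow> 'a"
  proof -
    obtain x f where xf: "x \<noteq> 0" "f \<noteq> 0" "X = outer_prod x f" using X rank_one_iff_outer_prod by blast
    then have n: "norm x * norm f = 1" using X by (simp add: onorm_outer_prod)
    have "X = outer_prod (norm f *\<^sub>R x) (f /\<^sub>R norm f)"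
      using xf by (simp add: outer_prod_scaleR_right)
    moreover have "norm (norm f *\<^sub>R x) = 1" using n by (simp add: mult.commute)
    ultimately show ?thesis using unit_multiple(1)[OF xf(2)] by blast
  qed
  define S where "S = {F X |X. X \<in> rank_one_ops \<and> onorm X = 1}"
  have S: "F (outer_prod x f) \<in> S" if "norm x * norm f = 1" for x f
  proof -
    have "x \<noteq> 0" "f \<noteq> 0" using that by auto
    then have "outer_prod x f \<in> rank_one_ops \<and> onorm (outer_prod x f) = 1"
      using that by (simp add: outer_prod_rank_one onorm_outer_prod)
    then show ?thesis unfolding S_def by blast
  qed
  have "(\<exists>M\<in>S. \<forall>s\<in>S. s \<le> M) \<and> (\<exists>m\<in>S. \<forall>s\<in>S. m \<le> s)"
    using assms unfolding attains_extrema_def Let_def S_def .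
  then obtain M m where Mm: "M \<in> S" "\<forall>s\<in>S. s \<le> M" "m \<in> S" "\<forall>s\<in>S. m \<le> s" by blast
  obtain X Y where X: "X \<in> rank_one_ops" "onorm X = 1" "M = F X"
    and Y: "Y \<in> rank_one_ops" "onorm Y = 1" "m = F Y" using Mm(1,3) unfolding S_def by blast
  obtain u v where uv: "norm u = 1" "norm v = 1" "X = outer_prod u v" using unit[OF X(1,2)] by blast
  obtain p q where pq: "norm p = 1" "norm q = 1" "Y = outer_prod p q" using unit[OF Y(1,2)] by blast
  show ?thesis
    by (rule that[OF uv(1,2) pq(1,2)]) (use Mm S X Y uv pq in auto)
qed

text \<open>Suppose first that \<open>b\<close> is not zero. Take test vectors \<open>f\<close> of norm \<open>1 / norm b\<close> that make \<open>f \<otimes> b\<close> a maximiser, respectively a minimiser, on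
  the unit sphere: strict growth along rays forbids the companion \<open>h \<otimes> b'\<close> to lie inside,
  respectively outside, the sphere. If \<open>b\<close> is zero, growth from the value at the zero operator forces
  \<open>b'\<close> to vanish.\<close>

lemma norm_eq_of_F_tests:
  assumes ext: "attains_extrema F"
    and test: "\<And>f. f \<noteq> 0 \<Longrightarrow> \<exists>h. norm h = norm f \<and> F (outer_prod h b') = F (outer_prod f b)"
  shows "norm b' = norm b"
proof -
  obtain u v p q where uv: "norm u = 1" "norm v = 1" and pq: "norm p = 1" "norm q = 1"
    and max: "\<And>x f. norm x * norm f = 1 \<Longrightarrow> F (outer_prod x f) \<le> F (outer_prod u v)"
    and min: "\<And>x f. norm x * norm f = 1 \<Longrightarrow> F (outer_prod p q) \<le> F (outer_prod x f)"
    using extremal_pairs[OF ext] by metis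
  have nz: "u \<noteq> 0" "v \<noteq> 0" using uv by auto
  show ?thesis
  proof (cases "b = 0")
    case True
    obtain h where h: "norm h = norm u" "F (outer_prod h b') = F (outer_prod u b)" using test[OF nz(1)] by blast
    then have "h \<noteq> 0" using nz by auto
    have "b' = 0"
    proof (rule ccontr)
      assume "b' \<noteq> 0"
      then show False using F_mono[OF \<open>h \<noteq> 0\<close>, of b' 0 1] h True by simp
    qed
    then show ?thesis using True by simp
  next
    case False
    define b1 where "b1 = b /\<^sub>R norm b"
    note b1 = unit_multiple[OF False, folded b1_def]
    (* The norm of h \<otimes> b' for every h of norm 1 / norm b. *)
    define r where "r = norm b' / norm b"
    (* A unitary W moves the unit vector y of an extremal pair onto b1 and carries x along. *)
    have reach: "\<exists>h. h \<noteq> 0 \<and> norm h = 1 / norm b \<and> F (outer_prod h b') = F (outer_prod x y)"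
      if xy: "norm x = 1" "norm y = 1" for x y
    proof -
      obtain W where W: "unitary_op W" "W y = b1" using unit_vector_transitive[OF xy(2) b1(1)] by blast
      have "F (outer_prod (W x /\<^sub>R norm b) b) = F (outer_prod (W x) b1)"
        by (simp add: outer_prod_scaleR_right b1_def)
      also have "\<dots> = F (outer_prod x y)" using F_unitary[OF W(1), of x y] xy W by force
      finally have "F (outer_prod (W x /\<^sub>R norm b) b) = F (outer_prod x y)" .
      moreover have n: "norm (W x /\<^sub>R norm b) = 1 / norm b"
        using xy unitary_opD(5)[OF W(1)] by (simp add: divide_inverse)
      moreover have "W x /\<^sub>R norm b \<noteq> 0" using n False by auto
      ultimately obtain h where h: "norm h = 1 / norm b" "F (outer_prod h b') = F (outer_prod x y)"
        using test by metis
      moreover have "h \<noteq> 0" using h(1) False by auto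
      ultimately show ?thesis by blast
    qed
    obtain h where h: "h \<noteq> 0" "norm h = 1 / norm b" "F (outer_prod h b') = F (outer_prod u v)"
      using reach[OF uv] by blast
    have "b' \<noteq> 0"
    proof
      assume "b' = 0"
      then show False using F_mono[OF nz, of 0 1] h(3) by simp
    qed
    have r0: "r > 0" using \<open>b' \<noteq> 0\<close> False by (simp add: r_def)
    have inside: "norm (h /\<^sub>R r) * norm b' = 1" if "norm h = 1 / norm b" for h :: 'a
      using that \<open>b' \<noteq> 0\<close> False by (simp add: r_def)
    have "\<not> r < 1"
    proof
      assume "r < 1"
      then have "F (outer_prod h b') < F (outer_prod (h /\<^sub>R r) b')"
        using F_mono[of "h /\<^sub>R r" b' r 1] r0 h(1) \<open>b' \<noteq> 0\<close> by simp
      then show False using max[OF inside[OF h(2)]] h(3) by simp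
    qed
    moreover have "\<not> 1 < r"
    proof
      assume "1 < r"
      obtain k where k: "k \<noteq> 0" "norm k = 1 / norm b" "F (outer_prod k b') = F (outer_prod p q)"
        using reach[OF pq] by blast
      have "F (outer_prod (k /\<^sub>R r) b') < F (outer_prod k b')"
        using F_mono[of "k /\<^sub>R r" b' 1 r] \<open>1 < r\<close> r0 k(1) \<open>b' \<noteq> 0\<close> by simp
      then show False using min[OF inside[OF k(2)]] k(3) by simp
    qed
    ultimately have "r = 1" by simp
    then show ?thesis using False by (simp add: r_def)
  qed
qed

end

section \<open>Operators whose adjoints have equal norms\<close>

text \<open>If the adjoints of \<open>B\<close> and \<open>C\<close> have the same norm at every vector, then \<open>B* x \<mapsto> C* x\<close> is a
  well defined isometry; its extension by zero off the closure of its domain is the partial isometry.\<close>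

lemma factor_through_partial_isometry:
  fixes B C :: "'a::complex_hilbert \<Rightarrow> 'a"
  assumes B: "B \<in> bounded_ops" and C: "C \<in> bounded_ops"
    and norm: "\<And>x. norm (cadj C x) = norm (cadj B x)"
  shows "\<exists>V. partial_isometry V \<and> cadj V \<circ> V = right_support B \<and> C = B \<circ> cadj V"
proof -
  note Bs = cadj_bounded_ops[OF B] and Cs = cadj_bounded_ops[OF C]
  define R where "R = range (cadj B)"
  define M where "M = closure R"
  (* The choice of the preimage x does not matter, because C* x - C* x' has the norm of B* x - B* x'. *)
  define g where "g y = cadj C (SOME x. cadj B x = y)" for y
  have dist: "dist (cadj C x) (cadj C y) = dist (cadj B x) (cadj B y)" for x y
    using norm[of "x - y"] by (simp add: dist_norm bounded_opsD[OF Bs] bounded_opsD[OF Cs])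
  have g: "g (cadj B x) = cadj C x" for x
  proof -
    have "cadj B (SOME z. cadj B z = cadj B x) = cadj B x" by (rule someI) (rule refl)
    then have "dist (g (cadj B x)) (cadj C x) = 0" unfolding g_def dist by simp
    then show ?thesis by simp
  qed
  have "uniformly_continuous_on R g"
    unfolding uniformly_continuous_on_def R_def by (auto simp: g dist)
  then obtain G where G: "uniformly_continuous_on M G" "\<And>x. x \<in> R \<Longrightarrow> g x = G x"
    using uniformly_continuous_on_extension_on_closure unfolding M_def by metis
  have GB: "G (cadj B x) = cadj C x" for x using G(2)[of "cadj B x"] g by (simp add: R_def)
  have contG: "continuous_on M G" by (rule uniformly_continuous_imp_continuous[OF G(1)])
  have approx: "\<exists>x. (\<lambda>n. cadj B (x n)) \<longlonglongrightarrow> y" if y: "y \<in> M" for y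
  proof -
    obtain z where z: "\<And>n. z n \<in> R" "z \<longlonglongrightarrow> y" using y unfolding M_def closure_sequential by auto
    have "\<forall>n. \<exists>x. z n = cadj B x" using z(1) unfolding R_def by blast
    then obtain x where "\<forall>n. z n = cadj B (x n)" by metis
    then have "z = (\<lambda>n. cadj B (x n))" by (intro ext) simp
    then show ?thesis using z(2) by blast
  qed
  have inM: "y \<in> M" if "(\<lambda>n. cadj B (x n)) \<longlonglongrightarrow> y" for x y
    unfolding M_def closure_sequential
    by (rule exI[of _ "\<lambda>n. cadj B (x n)"]) (use that in \<open>simp add: R_def\<close>)
  have limG: "(\<lambda>n. cadj C (x n)) \<longlonglongrightarrow> G y" if "(\<lambda>n. cadj B (x n)) \<longlonglongrightarrow> y" for x y
  proof -
    have "(\<lambda>n. G (cadj B (x n))) \<longlonglongrightarrow> G y"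
      by (rule continuous_on_tendsto_compose[OF contG that inM[OF that]])
        (auto simp: M_def R_def intro!: always_eventually closure_subset[THEN subsetD])
    then show ?thesis by (simp add: GB)
  qed
  have add: "y + z \<in> M \<and> G (y + z) = G y + G z" if yz: "y \<in> M" "z \<in> M" for y z
  proof -
    obtain s t where s: "(\<lambda>n. cadj B (s n)) \<longlonglongrightarrow> y" and t: "(\<lambda>n. cadj B (t n)) \<longlonglongrightarrow> z"
      using approx[OF yz(1)] approx[OF yz(2)] by blast
    have st: "(\<lambda>n. cadj B (s n + t n)) \<longlonglongrightarrow> y + z"
      using tendsto_add[OF s t] by (simp add: bounded_opsD[OF Bs])
    have "(\<lambda>n. cadj C (s n + t n)) \<longlonglongrightarrow> G y + G z"
      using tendsto_add[OF limG[OF s] limG[OF t]] by (simp add: bounded_opsD[OF Cs])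
    then show ?thesis using LIMSEQ_unique[OF limG[OF st]] inM[OF st] by blast
  qed
  have scale: "c *\<^sub>C y \<in> M \<and> G (c *\<^sub>C y) = c *\<^sub>C G y" if y: "y \<in> M" for c y
  proof -
    note lim = bounded_linear.tendsto[OF bounded_linear_scaleC[of c]]
    obtain s where s: "(\<lambda>n. cadj B (s n)) \<longlonglongrightarrow> y" using approx[OF y] by blast
    have st: "(\<lambda>n. cadj B (c *\<^sub>C s n)) \<longlonglongrightarrow> c *\<^sub>C y"
      using lim[OF s] by (simp add: bounded_opsD[OF Bs])
    have "(\<lambda>n. cadj C (c *\<^sub>C s n)) \<longlonglongrightarrow> c *\<^sub>C G y"
      using lim[OF limG[OF s]] by (simp add: bounded_opsD[OF Cs])
    then show ?thesis using LIMSEQ_unique[OF limG[OF st]] inM[OF st] by blast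
  qed
  have Gnorm: "norm (G y) = norm y" if y: "y \<in> M" for y
  proof -
    obtain s where s: "(\<lambda>n. cadj B (s n)) \<longlonglongrightarrow> y" using approx[OF y] by blast
    have "(\<lambda>n. norm (cadj C (s n))) \<longlonglongrightarrow> norm (G y)" by (intro tendsto_norm limG s)
    moreover have "(\<lambda>n. norm (cadj C (s n))) \<longlonglongrightarrow> norm y" using tendsto_norm[OF s] by (simp add: norm)
    ultimately show ?thesis by (rule LIMSEQ_unique)
  qed
  have RM: "cadj B x \<in> M" for x unfolding M_def R_def by (rule closure_subset[THEN subsetD]) simp
  have M: "csubspace_closed M"
    unfolding csubspace_closed_def complex_vector.subspace_def
    using add scale RM[of 0] bounded_opsD(5)[OF Bs] by (auto simp: M_def)
  define P where "P = orth_projection M"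
  note PM = orth_projection_props[OF M, folded P_def]
  note M' = csubspace_closedD[OF M]
  note N' = csubspace_closedD[OF corthogonal_comp_closed_subspace[of M]]
  have P_eqI: "P x = y" if "y \<in> M" "x - y \<in> corthogonal_comp M" for x y
    unfolding P_def by (rule orth_projection_eqI[OF M that])
  have P_add: "P (x + y) = P x + P y" for x y
  proof (rule P_eqI)
    show "x + y - (P x + P y) \<in> corthogonal_comp M"
      using N'(2)[OF PM(2)[of x] PM(2)[of y]] by (simp add: algebra_simps)
  qed (intro M' PM)
  have P_scale: "P (c *\<^sub>C x) = c *\<^sub>C P x" for c x
  proof (rule P_eqI)
    show "c *\<^sub>C x - c *\<^sub>C P x \<in> corthogonal_comp M"
      using N'(3)[OF PM(2)[of x], of c] by (simp add: complex_vector.scale_right_diff_distrib)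
  qed (intro M' PM)
  have P_M: "P x = x" if "x \<in> M" for x
    by (rule P_eqI[OF that]) (simp add: N'(1))
  have P_cinner: "cinner (P x) (P y) = cinner (P x) y" for x y
  proof -
    have "cinner (y - P y) (P x) = 0" using PM by (simp add: corthogonal_comp_def)
    then have "cinner (P x) (y - P y) = 0" by (rule cinner_eq_0_sym)
    then show ?thesis by (simp add: cinner_diff_right)
  qed
  have P_norm: "norm (P x) \<le> norm x" for x
  proof -
    have "(norm (P x))\<^sup>2 = cmod (cinner (P x) (P x))" unfolding cinner_self norm_of_real by simp
    also have "\<dots> \<le> norm (P x) * norm x" unfolding P_cinner by (rule norm_cinner_le)
    finally show ?thesis by (cases "P x = 0") (simp_all add: power2_eq_square)
  qed
  define V where "V x = G (P x)" for x
  have V_norm: "norm (V x) = norm (P x)" for x by (simp add: V_def Gnorm PM)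
  have V_add: "V (x + y) = V x + V y" for x y by (simp add: V_def P_add add PM)
  have V_scale: "V (c *\<^sub>C x) = c *\<^sub>C V x" for c x by (simp add: V_def P_scale scale PM)
  have V: "V \<in> bounded_ops"
    by (rule bounded_opsI[of _ 1]) (simp_all add: V_add V_scale V_norm P_norm)
  have "kernel V = corthogonal_comp M"
  proof -
    have "x \<in> kernel V \<longleftrightarrow> P x = 0" for x using V_norm[of x] by (simp add: kernel_def) (metis norm_eq_zero)
    moreover have "P x = 0 \<longleftrightarrow> x \<in> corthogonal_comp M" for x
      using PM(2)[of x] P_eqI[of 0 x] M'(1) by auto
    ultimately show ?thesis by blast
  qed
  then have "corthogonal_comp (kernel V) = M" by (simp add: double_corthogonal_comp[OF M])
  then have "partial_isometry V" using V by (simp add: partial_isometry_def V_norm P_M)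
  moreover have "cadj V \<circ> V = P"
  proof
    fix x
    have "cinner (V x) (V y) = cinner (P x) (P y)" for x y
      by (rule cinner_eq_of_norm_eq) (simp_all add: V_add V_scale P_add P_scale V_norm)
    then have "cinner (cadj V (V x)) y = cinner (P x) y" for y
      by (simp add: cadj_cinner'[OF V, symmetric] P_cinner)
    then show "(cadj V \<circ> V) x = P x" by (simp add: cinner_eqI)
  qed
  moreover have "P = right_support B"
  proof -
    have "kernel B = corthogonal_comp M"
    proof (intro set_eqI iffI)
      fix x assume "x \<in> corthogonal_comp M"
      then have "cinner (B x) z = 0" for z
        unfolding cadj_cinner[OF B] using RM by (simp add: corthogonal_comp_def)
      then have "cinner (B x) (B x) = 0" .
      then show "x \<in> kernel B" by (simp add: kernel_def)
    next
      fix x assume "x \<in> kernel B"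
      then have z: "cinner x (cadj B z) = 0" for z by (simp add: kernel_def cadj_cinner[OF B, symmetric])
      have "cinner x y = 0" if y: "y \<in> M" for y
      proof -
        obtain s where s: "(\<lambda>n. cadj B (s n)) \<longlonglongrightarrow> y" using approx[OF y] by blast
        have "(\<lambda>n. cinner x (cadj B (s n))) \<longlonglongrightarrow> cinner x y" by (rule tendsto_cinner_right[OF s])
        then show ?thesis by (simp add: z LIMSEQ_const_iff)
      qed
      then show "x \<in> corthogonal_comp M" by (simp add: corthogonal_comp_def)
    qed
    then show ?thesis by (simp add: right_support_def P_def double_corthogonal_comp[OF M])
  qed
  moreover have "C = B \<circ> cadj V"
  proof -
    have "cadj C = V \<circ> cadj B" by (auto simp: V_def P_M RM GB)
    then have "cadj (cadj C) = cadj (cadj B) \<circ> cadj V" by (simp add: cadj_comp[OF V Bs])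
    then show ?thesis by (simp add: cadj_cadj B C)
  qed
  ultimately show ?thesis by blast
qed

section \<open>The structure of the map\<close>

context orthogonality_map
begin

text \<open>In the antilinear case \<open>T \<circ> J\<close> is linear, and \<open>T\<close> is recovered from it because \<open>J\<close> is an involution.\<close>

lemma rank_one_form_exists:
  assumes E: "orthogonal_basis E"
  obtains U h where "rank_one_form E AA \<Phi> U h" "\<And>x f. x = 0 \<or> f = 0 \<Longrightarrow> h x f = f"
proof -
  obtain T s h where s: "s = id \<or> s = cnj" and T: "\<And>x y. T (x + y) = T x + T y"
    "\<And>c x. T (c *\<^sub>C x) = s c *\<^sub>C T x" "\<And>x. norm (T x) = norm x" "\<And>y. \<exists>x. T x = y"
    and Phi: "\<And>x f. outer_prod x f \<in> AA \<Longrightarrow> \<Phi> (outer_prod x f) = outer_prod (T x) (h x f)"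
    and h: "\<And>x f. x = 0 \<or> f = 0 \<Longrightarrow> h x f = f"
    by (rule rank_one_action) blast
  note J = conjugation_props[OF E]
  note Jnorm = norm_conjugation[OF E]
  from s show ?thesis
  proof
    assume s: "s = id"
    have "unitary_op T" by (rule unitary_opI) (simp_all add: T(1-3) T(4) s)
    then have "rank_one_form E AA \<Phi> T h" using Phi by (simp add: rank_one_form_def)
    then show ?thesis using h by (rule that)
  next
    assume s: "s = cnj"
    define U where "U x = T (conjugation E x)" for x
    have "unitary_op U"
    proof (rule unitary_opI)
      show "\<exists>x. U x = y" for y
      proof -
        obtain x where "T x = y" using T(4)[of y] by blast
        then have "U (conjugation E x) = y" by (simp add: U_def J)
        then show ?thesis by blast
      qed
    qed (simp_all add: U_def T(1-3) J s Jnorm)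
    then have "rank_one_form E AA \<Phi> U h" using Phi by (simp add: rank_one_form_def U_def J)
    then show ?thesis using h by (rule that)
  qed
qed

end

locale invariant_preserving_map = orthogonality_map AA BB \<Phi> + monotone_invariant F
  for AA BB :: "('a::complex_hilbert \<Rightarrow> 'a) set" and \<Phi> F +
  assumes F_pres: "A \<in> AA \<Longrightarrow> B \<in> AA \<Longrightarrow> A \<in> rank_one_ops \<or> B \<in> rank_one_ops \<Longrightarrow>
    F (cadj (\<Phi> A) \<circ> \<Phi> B) = F (cadj A \<circ> B)"
begin

text \<open>Pair the operator with itself: the product is \<open>\<parallel>x\<parallel>\<^sup>2 f \<otimes> f\<close> before and \<open>\<parallel>x\<parallel>\<^sup>2 h \<otimes> h\<close> after applying \<open>\<Phi>\<close>.\<close>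

lemma norm_second_factor:
  assumes Phi: "\<Phi> (outer_prod x f) = outer_prod y h" and y: "norm y = norm x"
    and x: "x \<noteq> 0" and AA: "outer_prod x f \<in> AA"
  shows "norm h = norm f"
proof (cases "f = 0")
  case True
  then have "outer_prod y h = (\<lambda>_. 0)" using Phi AA Phi_zero by simp
  moreover have "y \<noteq> 0" using x y by auto
  ultimately show ?thesis using True by (simp add: outer_prod_eq_0)
next
  case False
  have sq: "cadj (outer_prod a g) \<circ> outer_prod a g = outer_prod ((norm a)\<^sup>2 *\<^sub>R g) g" for a g :: 'a
  proof -
    have "outer_prod g a a = (norm a)\<^sup>2 *\<^sub>R g" unfolding outer_prod_def cinner_self scaleC_of_real ..
    then show ?thesis
      by (subst cadj_outer_comp[OF outer_prod_bounded_ops])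
        (simp only: cadj_outer_prod outer_prod_scaleR_right)
  qed
  have "F (cadj (outer_prod y h) \<circ> outer_prod y h) = F (cadj (outer_prod x f) \<circ> outer_prod x f)"
    using F_pres[OF AA AA] outer_prod_rank_one[OF x False] by (simp add: Phi)
  then have "F (outer_prod ((norm x)\<^sup>2 *\<^sub>R h) h) = F (outer_prod ((norm x)\<^sup>2 *\<^sub>R f) f)"
    unfolding sq y .
  then show ?thesis by (rule norm_eq_of_F_self[rotated 2]) (use x False in simp_all)
qed

text \<open>Pairing \<open>x \<otimes> f\<close> with \<open>B\<close> for all \<open>f\<close> tests the vector \<open>B\<^sup>*x\<close>, and its image with \<open>\<Phi> B\<close> tests
  \<open>(\<Phi> B)\<^sup>*T x\<close>; the value of \<open>F\<close> and the norm of the other factor agree.\<close>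

lemma norm_cadj_Phi:
  assumes ext: "attains_extrema F" and B: "B \<in> AA"
    and Phi: "\<And>x f. outer_prod x f \<in> AA \<Longrightarrow> \<Phi> (outer_prod x f) = outer_prod (T x) (h x f)"
    and T: "\<And>x. norm (T x) = norm x"
  shows "norm (cadj (\<Phi> B) (T x)) = norm (cadj B x)"
proof (cases "x = 0")
  case True
  then have "T x = 0" using T[of x] by simp
  moreover have "B \<in> bounded_ops" using B AA by blast
  ultimately show ?thesis
    by (simp only: True bounded_opsD(5)[OF cadj_bounded_ops] Phi_bounded[OF B])
next
  case False
  show ?thesis
  proof (rule norm_eq_of_F_tests[OF ext])
    fix f :: 'a assume f: "f \<noteq> 0"
    have A: "outer_prod x f \<in> AA" "outer_prod x f \<in> rank_one_ops"
      using outer_in_AA outer_prod_rank_one False f by auto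
    have "B \<in> bounded_ops" using B AA by blast
    then have "F (outer_prod (h x f) (cadj (\<Phi> B) (T x))) = F (outer_prod f (cadj B x))"
      using F_pres[OF A(1) B] A(2) Phi_bounded[OF B] by (simp add: Phi[OF A(1)] cadj_outer_comp)
    moreover have "norm (h x f) = norm f" by (rule norm_second_factor[OF Phi[OF A(1)] T False A(1)])
    ultimately show "\<exists>g. norm g = norm f \<and>
        F (outer_prod g (cadj (\<Phi> B) (T x))) = F (outer_prod f (cadj B x))" by blast
  qed
qed

text \<open>Here \<open>D\<close> is \<open>B\<close> or \<open>J B J\<close>. The factorisation applies to \<open>U\<^sup>*\<Phi> B\<close>, whose adjoint has the norms of that of
  \<open>D\<close>.\<close>

lemma Phi_factorisation:
  assumes B: "B \<in> AA" and U: "unitary_op U" and D: "D \<in> bounded_ops"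
    and norm: "\<And>x. norm (cadj (\<Phi> B) (U x)) = norm (cadj D x)"
  shows "\<exists>V. partial_isometry V \<and> cadj V \<circ> V = right_support D \<and> \<Phi> B = U \<circ> D \<circ> cadj V"
proof -
  note PB = Phi_bounded[OF B] and U' = unitary_opD[OF U]
  have Us: "cadj U \<in> bounded_ops" by (rule cadj_bounded_ops[OF U'(1)])
  have C: "cadj U \<circ> \<Phi> B \<in> bounded_ops" by (rule bounded_ops_comp[OF Us PB])
  have "cadj (cadj U \<circ> \<Phi> B) = cadj (\<Phi> B) \<circ> U" by (simp add: cadj_comp[OF Us PB] cadj_cadj[OF U'(1)])
  then have "norm (cadj (cadj U \<circ> \<Phi> B) x) = norm (cadj D x)" for x by (simp add: norm)
  from factor_through_partial_isometry[OF D C this]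
  obtain V where V: "partial_isometry V" "cadj V \<circ> V = right_support D" "cadj U \<circ> \<Phi> B = D \<circ> cadj V"
    by blast
  have "\<Phi> B = U \<circ> (cadj U \<circ> \<Phi> B)" by (auto simp: U')
  then have "\<Phi> B = U \<circ> D \<circ> cadj V" unfolding V(3) by (simp only: o_assoc)
  then show ?thesis using V by blast
qed

end

theorem theorem2p2:
  fixes E :: "'a::complex_hilbert set"
    and AA BB :: "('a \<Rightarrow> 'a) set"
    and \<Phi> :: "('a \<Rightarrow> 'a) \<Rightarrow> ('a \<Rightarrow> 'a)"
    and F :: "('a \<Rightarrow> 'a) \<Rightarrow> real"
  defines "J \<equiv> conjugation E"
  assumes basis: "orthogonal_basis E"
    and dim: "infinite E \<or> card E \<ge> 3"
    and AA: "rank_one_ops \<subseteq> AA" "AA \<subseteq> bounded_ops"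
    and BB: "rank_one_ops \<subseteq> BB" "BB \<subseteq> bounded_ops"
    and surj: "\<Phi> ` AA = BB"
    and orth: "\<And>A B. A \<in> AA \<Longrightarrow> B \<in> AA \<Longrightarrow>
        (cadj A \<circ> B = (\<lambda>_. 0)) \<longleftrightarrow> (cadj (\<Phi> A) \<circ> \<Phi> B = (\<lambda>_. 0))"
    and F_nonneg: "\<And>X. X \<in> rank_one_ops \<union> {\<lambda>_. 0} \<Longrightarrow> F X \<ge> 0"
    and F_pres: "\<And>A B. A \<in> AA \<Longrightarrow> B \<in> AA \<Longrightarrow> A \<in> rank_one_ops \<or> B \<in> rank_one_ops \<Longrightarrow>
        F (cadj (\<Phi> A) \<circ> \<Phi> B) = F (cadj A \<circ> B)"
  shows "(\<forall>A\<in>AA. A \<in> rank_one_ops \<longleftrightarrow> \<Phi> A \<in> rank_one_ops) \<and>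
    (\<exists>U\<^sub>0 h. rank_one_form E AA \<Phi> U\<^sub>0 h \<and>
       (unitarily_invariant F \<and> strictly_increasing_on_rays F \<longrightarrow>
          (\<forall>x f. norm (h x f) = norm f))) \<and>
    (unitarily_invariant F \<and> strictly_increasing_on_rays F \<longrightarrow>
       (\<forall>U\<^sub>0 h. rank_one_form E AA \<Phi> U\<^sub>0 h \<longrightarrow>
          (\<forall>x f. x \<noteq> 0 \<and> outer_prod x f \<in> AA \<longrightarrow> norm (h x f) = norm f))) \<and>
    (unitarily_invariant F \<and> strictly_increasing_on_rays F \<and> attains_extrema F \<longrightarrow>
       (\<exists>U. unitary_op U \<and>
          ((\<exists>V. \<forall>A\<in>AA. partial_isometry (V A) \<and>
              cadj (V A) \<circ> V A = right_support A \<and>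
              \<Phi> A = U \<circ> A \<circ> cadj (V A)) \<or>
           (\<exists>V. \<forall>A\<in>AA. partial_isometry (V A) \<and>
              cadj (V A) \<circ> V A = right_support (J \<circ> A \<circ> J) \<and>
              \<Phi> A = U \<circ> (J \<circ> A \<circ> J) \<circ> cadj (V A)))))"
proof -
  interpret orthogonality_map AA BB \<Phi>
  proof
    show "\<exists>c :: 'a. c \<noteq> 0 \<and> cinner c a = 0 \<and> cinner c b = 0" for a b
      by (rule exists_orthogonal_to_two[OF basis dim])
  qed (use AA BB surj orth in auto)
  note J = conjugation_props[OF basis, folded J_def]
  note Jnorm = norm_conjugation[OF basis, folded J_def]
  have inv_loc: "invariant_preserving_map AA BB \<Phi> F"
    if "unitarily_invariant F" "strictly_increasing_on_rays F"
    by unfold_locales (use that F_pres in auto)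
  have form: "(\<forall>x f. outer_prod x f \<in> AA \<longrightarrow> \<Phi> (outer_prod x f) = outer_prod (U x) (h x f)) \<or>
      (\<forall>x f. outer_prod x f \<in> AA \<longrightarrow> \<Phi> (outer_prod x f) = outer_prod (U (J x)) (h x f))"
    "unitary_op U" if "rank_one_form E AA \<Phi> U h" for U h
    using that unfolding rank_one_form_def J_def by simp_all
  have norm_h: "norm (h x f) = norm f"
    if F: "unitarily_invariant F" "strictly_increasing_on_rays F"
      and r: "rank_one_form E AA \<Phi> U h" and x: "x \<noteq> 0" "outer_prod x f \<in> AA" for U h x f
  proof -
    interpret invariant_preserving_map AA BB \<Phi> F by (rule inv_loc[OF F])
    note U = unitary_opD(5)[OF form(2)[OF r]]
    from form(1)[OF r] show ?thesis
    proof
      assume "\<forall>x f. outer_prod x f \<in> AA \<longrightarrow> \<Phi> (outer_prod x f) = outer_prod (U x) (h x f)"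
      then have "\<Phi> (outer_prod x f) = outer_prod (U x) (h x f)" using x by simp
      then show ?thesis by (rule norm_second_factor[OF _ U x])
    next
      assume "\<forall>x f. outer_prod x f \<in> AA \<longrightarrow> \<Phi> (outer_prod x f) = outer_prod (U (J x)) (h x f)"
      then have "\<Phi> (outer_prod x f) = outer_prod (U (J x)) (h x f)" using x by simp
      moreover have "norm (U (J x)) = norm x" by (simp add: U Jnorm)
      ultimately show ?thesis by (rule norm_second_factor[OF _ _ x])
    qed
  qed
  obtain U h where U: "rank_one_form E AA \<Phi> U h" and h: "\<And>x f. x = 0 \<or> f = 0 \<Longrightarrow> h x f = f"
    by (rule rank_one_form_exists[OF basis]) blast
  note unitary = form(2)[OF U]
  have all_norm_h: "norm (h x f) = norm f"
    if F: "unitarily_invariant F" "strictly_increasing_on_rays F" for x f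
  proof (cases "x = 0 \<or> f = 0")
    case False
    then show ?thesis by (intro norm_h[OF F U] outer_in_AA) simp_all
  qed (simp add: h)
  have factor: "(\<exists>V. \<forall>A\<in>AA. partial_isometry (V A) \<and> cadj (V A) \<circ> V A = right_support A \<and>
        \<Phi> A = U \<circ> A \<circ> cadj (V A)) \<or>
      (\<exists>V. \<forall>A\<in>AA. partial_isometry (V A) \<and> cadj (V A) \<circ> V A = right_support (J \<circ> A \<circ> J) \<and>
        \<Phi> A = U \<circ> (J \<circ> A \<circ> J) \<circ> cadj (V A))"
    if F: "unitarily_invariant F" "strictly_increasing_on_rays F" and ext: "attains_extrema F"
  proof -
    interpret invariant_preserving_map AA BB \<Phi> F by (rule inv_loc[OF F])
    note Unorm = unitary_opD(5)[OF unitary]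
    from form(1)[OF U] consider
      (linear) "\<forall>x f. outer_prod x f \<in> AA \<longrightarrow> \<Phi> (outer_prod x f) = outer_prod (U x) (h x f)"
      | (conj) "\<forall>x f. outer_prod x f \<in> AA \<longrightarrow> \<Phi> (outer_prod x f) = outer_prod (U (J x)) (h x f)"
      by (rule disjE)
    then show ?thesis
    proof cases
      case linear
      have "\<exists>V. partial_isometry V \<and> cadj V \<circ> V = right_support A \<and> \<Phi> A = U \<circ> A \<circ> cadj V"
        if A: "A \<in> AA" for A
      proof (rule Phi_factorisation[OF A unitary])
        show "A \<in> bounded_ops" using A AA by blast
        show "norm (cadj (\<Phi> A) (U x)) = norm (cadj A x)" for x
          by (rule norm_cadj_Phi[OF ext A, of U h]) (use linear Unorm in auto)
      qed
      then show ?thesis by metis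
    next
      case conj
      have "\<exists>V. partial_isometry V \<and> cadj V \<circ> V = right_support (J \<circ> A \<circ> J) \<and>
          \<Phi> A = U \<circ> (J \<circ> A \<circ> J) \<circ> cadj V" if A: "A \<in> AA" for A
      proof (rule Phi_factorisation[OF A unitary])
        have Ab: "A \<in> bounded_ops" using A AA by blast
        obtain K where K: "\<And>x. norm (A x) \<le> norm x * K"
          using bounded_linear.bounded[OF bounded_opsD(1)[OF Ab]] by blast
        show "J \<circ> A \<circ> J \<in> bounded_ops"
        proof (rule bounded_opsI[of _ K])
          show "norm ((J \<circ> A \<circ> J) x) \<le> K * norm x" for x
            using K[of "J x"] by (simp add: Jnorm mult.commute)
        qed (simp_all add: J bounded_opsD[OF Ab])
        (* J is antilinear, but its two conjugations cancel in the adjoint. *)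
        have adj: "cadj (J \<circ> A \<circ> J) = J \<circ> cadj A \<circ> J"
        proof (rule cadj_eqI)
          fix x y
          have "cinner ((J \<circ> A \<circ> J) x) y = cinner (J (A (J x))) (J (J y))" by (simp add: J(3))
          also have "\<dots> = cnj (cinner (J x) (cadj A (J y)))" by (simp add: J(4) cadj_cinner[OF Ab])
          also have "\<dots> = cinner (J (J x)) (J (cadj A (J y)))" by (simp only: J(4))
          finally show "cinner ((J \<circ> A \<circ> J) x) y = cinner x ((J \<circ> cadj A \<circ> J) y)" by (simp add: J(3))
        qed
        show "norm (cadj (\<Phi> A) (U x)) = norm (cadj (J \<circ> A \<circ> J) x)" for x
        proof -
          have "norm (cadj (\<Phi> A) (U (J (J x)))) = norm (cadj A (J x))"
            by (rule norm_cadj_Phi[OF ext A, of "\<lambda>x. U (J x)" h]) (use conj Unorm Jnorm in auto)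
          then show ?thesis by (simp add: J(3) adj Jnorm)
        qed
      qed
      then show ?thesis by metis
    qed
  qed
  show ?thesis
  proof (intro conjI impI)
    show "\<forall>A\<in>AA. A \<in> rank_one_ops \<longleftrightarrow> \<Phi> A \<in> rank_one_ops" using rank_one_Phi by blast
    show "\<exists>U\<^sub>0 h. rank_one_form E AA \<Phi> U\<^sub>0 h \<and>
       (unitarily_invariant F \<and> strictly_increasing_on_rays F \<longrightarrow> (\<forall>x f. norm (h x f) = norm f))"
      by (intro exI[of _ U] exI[of _ h]) (simp add: U all_norm_h)
  next
    assume F: "unitarily_invariant F \<and> strictly_increasing_on_rays F"
    show "\<forall>U\<^sub>0 h. rank_one_form E AA \<Phi> U\<^sub>0 h \<longrightarrow>
        (\<forall>x f. x \<noteq> 0 \<and> outer_prod x f \<in> AA \<longrightarrow> norm (h x f) = norm f)"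
      using norm_h[OF conjunct1[OF F] conjunct2[OF F]] by (intro allI impI) (elim conjE)
  next
    assume F: "unitarily_invariant F \<and> strictly_increasing_on_rays F \<and> attains_extrema F"
    show "\<exists>U. unitary_op U \<and>
          ((\<exists>V. \<forall>A\<in>AA. partial_isometry (V A) \<and>
              cadj (V A) \<circ> V A = right_support A \<and>
              \<Phi> A = U \<circ> A \<circ> cadj (V A)) \<or>
           (\<exists>V. \<forall>A\<in>AA. partial_isometry (V A) \<and>
              cadj (V A) \<circ> V A = right_support (J \<circ> A \<circ> J) \<and>
              \<Phi> A = U \<circ> (J \<circ> A \<circ> J) \<circ> cadj (V A)))"
      by (intro exI[of _ U] conjI unitary factor) (use F in simp_all)
  qed
qed

end
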